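(* Let $N\ge1$, let $K\in T(M)$, and let $\hat u_N=\sum_{i=0}^N\varepsilon^i\eta_i$. Let $$\hat\eta_{Nt}=\hat K_N(\hat\eta_N),\qquad\text{i.e.}\quad \eta_{it}=\frac1{i!}\left.\frac{\partial^iK(\hat u_N)}{\partial\varepsilon^i}\right|_{\varepsilon=0},\ 0\le i\le N,$$ be the $N$-th order perturbation equation of $u_t=K(u)$, and for a linear operator $\Phi:T(M)\to T(M)$ let $\hat\Phi_N:T(\hat M_N)\to T(\hat M_N)$ be the lower-triangular block operator $$\hat{\Phi}_N(\hat{\eta}_N)=\left[\frac{1}{(i-j)!}\left.\frac{\partial^{i-j}\Phi(\hat u_N)}{\partial\varepsilon^{i-j}}\right|_{\varepsilon=0}\right]_{i,j=0,1,\dots,N}\quad(\text{blocks with } i<j \text{ are zero}).$$ If $\Phi$ is a recursion operator of $u_t=K(u)$, then $\hat\Phi_N$ is a recursion operator of the perturbation equation $\hat\eta_{Nt}=\hat K_N(\hat\eta_N)$. Therefore, if $u_t=K(u)$ has a hereditary recursion operator $\Phi(u)$, then $\hat\eta_{Nt}=\hat K_N(\hat\eta_N)$ has the hereditary recursion operator $\hat\Phi_N(\hat\eta_N)$.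
   Context: Setting. $M=M(u)$ is a manifold with variable $u$, a column vector with $q$ components (typically functions); it is treated as a linear space, so that $u+\varepsilon S$ makes sense and tangent vectors at all points lie in one fixed space $E$. $\hat M_N=\hat M_N(\hat\eta_N)$ is the analogous manifold with variable $\hat\eta_N=(\eta_0^T,\dots,\eta_N^T)^T$, each $\eta_i$ being of the same kind and dimension as $u$; its tangent vectors are $(N+1)$-tuples of elements of $E$, and operators on them are $(N+1)\times(N+1)$ block matrices. $T(M)$, $T(\hat M_N)$ denote tangent bundles; $K\in T(M)$ means that $K$ is a vector field. All objects are assumed smooth, with as many derivatives as needed. Gateaux derivative: $X'(u)[S(u)]=\left.\frac{\partial}{\partial\varepsilon}X(u+\varepsilon S(u))\right|_{\varepsilon=0}$. A linear operator $\Phi:T(M)\to T(M)$ (possibly depending explicitly on $t$) is a recursion operator of $u_t=K(u)$ if for all $S\in T(M)$ and $u\in M$ $$\frac{\partial\Phi(u)}{\partial t}S(u)+\Phi'(u)[K(u)]S(u)-K'(u)[\Phi(u)S(u)]+\Phi(u)K'(u)[S(u)]=0,$$ where $\partial/\partial t$ is the derivative with respect to explicit $t$-dependence. It is hereditary if for all $K,S\in T(M)$ and $u\in M$ $$\Phi'(u)[\Phi(u)K(u)]S(u)-\Phi(u)\Phi'(u)[K(u)]S(u)-\Phi'(u)[\Phi(u)S(u)]K(u)+\Phi(u)\Phi'(u)[S(u)]K(u)=0.$$ The same definitions apply on $\hat M_N$. *)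

theory Defs
  imports "HOL-Analysis.Analysis"
begin

section \<open>Locally convex spaces\<close>

text \<open>
  The unknown \<open>u\<close> typically ranges over a space of vector-valued smooth functions, which is not
  normable in a way that makes differential operators continuous.  The state space is therefore an
  arbitrary Hausdorff locally convex real topological vector space.
\<close>

class locally_convex_space = real_vector + t2_space + topological_ab_group_add +
  assumes tendsto_scaleR_Pair: "((\<lambda>p. fst p *\<^sub>R snd p) \<longlongrightarrow> a *\<^sub>R b) (nhds a \<times>\<^sub>F nhds b)"
    and locally_convex_zero:
      "open U \<Longrightarrow> 0 \<in> U \<Longrightarrow> \<exists>V. open V \<and> 0 \<in> V \<and> V \<subseteq> U \<and>
        (\<forall>x\<in>V. \<forall>y\<in>V. \<forall>s\<ge>0. \<forall>t\<ge>0. s + t = 1 \<longrightarrow> s *\<^sub>R x + t *\<^sub>R y \<in> V)"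

lemma locally_convex_nhd:
  fixes U :: "'a::locally_convex_space set"
  assumes "open U" "0 \<in> U"
  shows "\<exists>V. open V \<and> convex V \<and> 0 \<in> V \<and> V \<subseteq> U"
  using locally_convex_zero[OF assms] unfolding convex_def by blast

lemma tendsto_scaleR_lcs:
  fixes g :: "'b \<Rightarrow> 'a::locally_convex_space"
  assumes "(f \<longlongrightarrow> a) F" "(g \<longlongrightarrow> b) F"
  shows "((\<lambda>x. f x *\<^sub>R g x) \<longlongrightarrow> a *\<^sub>R b) F"
  using filterlim_compose[OF tendsto_scaleR_Pair filterlim_Pair[OF assms]] by simp

lemma vec_separation:
  fixes x y :: "('a, 'b::finite) vec"
  assumes "x \<noteq> y"
  obtains i where "x $ i \<noteq> y $ i"
  using assms by (auto simp: vec_eq_iff)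

instance vec :: (t0_space, finite) t0_space
proof
  fix x y :: "('a, 'b) vec"
  assume "x \<noteq> y"
  then obtain i where i: "x $ i \<noteq> y $ i" by (rule vec_separation)
  then obtain U where "open U" "\<not> (x $ i \<in> U \<longleftrightarrow> y $ i \<in> U)"
    using t0_space_class.t0_space[OF i] by blast
  then show "\<exists>U. open U \<and> \<not> (x \<in> U \<longleftrightarrow> y \<in> U)"
    by (intro exI[of _ "(\<lambda>z. z $ i) -` U"]) (auto intro: open_vimage_vec_nth)
qed

instance vec :: (t1_space, finite) t1_space
proof
  fix x y :: "('a, 'b) vec"
  assume "x \<noteq> y"
  then obtain i where i: "x $ i \<noteq> y $ i" by (rule vec_separation)
  then obtain U where "open U" "x $ i \<in> U" "y $ i \<notin> U"
    using t1_space[OF i] by blast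
  then show "\<exists>U. open U \<and> x \<in> U \<and> y \<notin> U"
    by (intro exI[of _ "(\<lambda>z. z $ i) -` U"]) (auto intro: open_vimage_vec_nth)
qed

instance vec :: (t2_space, finite) t2_space
proof
  fix x y :: "('a, 'b) vec"
  assume "x \<noteq> y"
  then obtain i where i: "x $ i \<noteq> y $ i" by (rule vec_separation)
  then obtain U V where "open U" "open V" "x $ i \<in> U" "y $ i \<in> V" "U \<inter> V = {}"
    using hausdorff[OF i] by blast
  then show "\<exists>U V. open U \<and> open V \<and> x \<in> U \<and> y \<in> V \<and> U \<inter> V = {}"
    by (intro exI[of _ "(\<lambda>z. z $ i) -` U"] exI[of _ "(\<lambda>z. z $ i) -` V"])
      (auto intro: open_vimage_vec_nth)
qed

instance vec :: (topological_monoid_add, finite) topological_monoid_add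
proof
  fix a b :: "('a, 'b) vec"
  show "LIM x nhds a \<times>\<^sub>F nhds b. fst x + snd x :> nhds (a + b)"
    by (intro vec_tendstoI)
      (auto intro!: tendsto_add tendsto_vec_nth filterlim_fst filterlim_snd)
qed

instance vec :: (topological_comm_monoid_add, finite) topological_comm_monoid_add ..

instance vec :: (topological_group_add, finite) topological_group_add
proof
  fix a :: "('a, 'b) vec"
  show "(uminus \<longlongrightarrow> - a) (nhds a)"
    by (intro vec_tendstoI)
      (auto intro!: tendsto_minus tendsto_vec_nth filterlim_ident)
qed

instance vec :: (topological_ab_group_add, finite) topological_ab_group_add ..

instance vec :: (locally_convex_space, finite) locally_convex_space
proof
  fix a :: real and b :: "('a, 'b) vec"
  show "((\<lambda>p. fst p *\<^sub>R snd p) \<longlongrightarrow> a *\<^sub>R b) (nhds a \<times>\<^sub>F nhds b)"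
    by (intro vec_tendstoI)
      (auto intro!: tendsto_scaleR_lcs tendsto_vec_nth filterlim_fst filterlim_snd)
next
  fix U :: "('a, 'b) vec set"
  assume "open U" "0 \<in> U"
  then obtain A where A: "\<And>i. open (A i)" "\<And>i. (0::('a,'b) vec) $ i \<in> A i"
      "\<And>y. (\<forall>i. y $ i \<in> A i) \<Longrightarrow> y \<in> U"
    unfolding open_vec_def by metis
  then have "\<forall>i. \<exists>V. open V \<and> convex V \<and> 0 \<in> V \<and> V \<subseteq> A i"
    by (auto intro!: locally_convex_nhd)
  then obtain V where V: "\<And>i. open (V i) \<and> convex (V i) \<and> 0 \<in> V i \<and> V i \<subseteq> A i"
    by metis
  have "open {y. \<forall>i. y $ i \<in> V i}"
    by (rule open_vector_box) (use V in blast)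
  moreover have "convex {y. \<forall>i. y $ i \<in> V i}"
    using V by (auto simp: convex_def)
  ultimately have "\<exists>V. open V \<and> convex V \<and> 0 \<in> V \<and> V \<subseteq> U"
    using V A(3) by (intro exI[of _ "{y. \<forall>i. y $ i \<in> V i}"]) (simp add: subset_iff)
  then show "\<exists>V. open V \<and> 0 \<in> V \<and> V \<subseteq> U \<and>
      (\<forall>x\<in>V. \<forall>y\<in>V. \<forall>s\<ge>0. \<forall>t\<ge>0. s + t = 1 \<longrightarrow> s *\<^sub>R x + t *\<^sub>R y \<in> V)"
    unfolding convex_def by blast
qed

instance real_normed_vector \<subseteq> locally_convex_space
proof
  fix a :: real and b :: 'a
  show "((\<lambda>p. fst p *\<^sub>R snd p) \<longlongrightarrow> a *\<^sub>R b) (nhds a \<times>\<^sub>F nhds b)"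
    by (intro tendsto_scaleR filterlim_fst filterlim_snd)
next
  fix U :: "'a set"
  assume "open U" "0 \<in> U"
  then obtain e where "e > 0" "ball 0 e \<subseteq> U"
    by (auto simp: open_contains_ball)
  then have "\<exists>V. open V \<and> convex V \<and> 0 \<in> V \<and> V \<subseteq> U"
    by (intro exI[of _ "ball 0 e"]) auto
  then show "\<exists>V. open V \<and> 0 \<in> V \<and> V \<subseteq> U \<and>
      (\<forall>x\<in>V. \<forall>y\<in>V. \<forall>s\<ge>0. \<forall>t\<ge>0. s + t = 1 \<longrightarrow> s *\<^sub>R x + t *\<^sub>R y \<in> V)"
    unfolding convex_def by blast
qed


section \<open>Gateaux calculus\<close>

definition curve_differentiable :: "(real \<Rightarrow> 'a::{real_vector, t2_space}) \<Rightarrow> real \<Rightarrow> bool" where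
  "curve_differentiable c x \<longleftrightarrow> (\<exists>D. ((\<lambda>h. (c (x + h) - c x) /\<^sub>R h) \<longlongrightarrow> D) (at 0))"

text \<open>As \<^const>\<open>vector_derivative\<close>, but without a norm; \<open>(curve_deriv ^^ k) c\<close> is the
  \<open>k\<close>-th derivative.\<close>

definition curve_deriv :: "(real \<Rightarrow> 'a::{real_vector, t2_space}) \<Rightarrow> real \<Rightarrow> 'a" where
  "curve_deriv c x = Lim (at 0) (\<lambda>h. (c (x + h) - c x) /\<^sub>R h)"

text \<open>\<open>gateaux X u v\<close> is \<open>X'(u)[v]\<close>.\<close>

definition gateaux ::
    "('a::real_vector \<Rightarrow> 'b::{real_vector, t2_space}) \<Rightarrow> 'a \<Rightarrow> 'a \<Rightarrow> 'b" where
  "gateaux X u v = curve_deriv (\<lambda>\<epsilon>. X (u + \<epsilon> *\<^sub>R v)) 0"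

text \<open>The iterated derivative of \<open>X\<close> at \<open>u\<close> in the fixed directions \<open>v 0, \<dots>, v (k - 1)\<close>.\<close>

primrec gateaux_iter ::
    "nat \<Rightarrow> ('a::real_vector \<Rightarrow> 'b::{real_vector, t2_space}) \<Rightarrow> (nat \<Rightarrow> 'a) \<Rightarrow> 'a \<Rightarrow> 'b" where
  "gateaux_iter 0 X v = X"
| "gateaux_iter (Suc k) X v = (\<lambda>u. gateaux (gateaux_iter k X v) u (v k))"

text \<open>
  The usual notion of a smooth map between locally convex spaces (Michal--Bastiani, Hamilton,
  Milnor): all iterated directional derivatives exist and are jointly continuous in the point and
  the directions.  The directions form a sequence, with the product topology, of which the
  derivative of order \<open>k\<close> only sees the first \<open>k\<close> members.
\<close>

definition smooth ::
    "('a::{real_vector, topological_space} \<Rightarrow> 'b::{real_vector, t2_space}) \<Rightarrow> bool" where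
  "smooth X \<longleftrightarrow>
     (\<forall>k v u. curve_differentiable (\<lambda>\<epsilon>. gateaux_iter k X v (u + \<epsilon> *\<^sub>R v k)) 0) \<and>
     (\<forall>k. continuous_on UNIV (\<lambda>(u, v). gateaux_iter k X v u))"


section \<open>Vector fields, recursion operators and hereditary operators\<close>

text \<open>
  The manifold is the linear space \<open>'a\<close>, and so is each of its tangent spaces.
\<close>

definition vector_field :: "('a::locally_convex_space \<Rightarrow> 'a) \<Rightarrow> bool" where
  "vector_field S \<longleftrightarrow> smooth S"

text \<open>
  \<open>\<Phi> t u w\<close> is \<open>\<Phi>(u)\<close> at explicit time \<open>t\<close>, applied to the tangent vector \<open>w\<close> at \<open>u\<close>.
\<close>

definition linear_operator :: "(real \<Rightarrow> 'a::locally_convex_space \<Rightarrow> 'a \<Rightarrow> 'a) \<Rightarrow> bool" where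
  "linear_operator \<Phi> \<longleftrightarrow> (\<forall>t u. linear (\<Phi> t u)) \<and> smooth (\<lambda>(t, u, w). \<Phi> t u w)"

text \<open>\<open>op_gateaux \<Phi> t u v w\<close> is \<open>\<Phi>'(u)[v] w\<close>, and \<open>op_time_deriv \<Phi> t u w\<close> is
  \<open>(\<partial>\<Phi>(u)/\<partial>t) w\<close>; the vector \<open>w\<close> is not differentiated.\<close>

definition op_gateaux ::
    "(real \<Rightarrow> 'a::locally_convex_space \<Rightarrow> 'a \<Rightarrow> 'a) \<Rightarrow> real \<Rightarrow> 'a \<Rightarrow> 'a \<Rightarrow> 'a \<Rightarrow> 'a" where
  "op_gateaux \<Phi> t u v w = gateaux (\<lambda>x. \<Phi> t x w) u v"

definition op_time_deriv ::
    "(real \<Rightarrow> 'a::locally_convex_space \<Rightarrow> 'a \<Rightarrow> 'a) \<Rightarrow> real \<Rightarrow> 'a \<Rightarrow> 'a \<Rightarrow> 'a" where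
  "op_time_deriv \<Phi> t u w = curve_deriv (\<lambda>s. \<Phi> s u w) t"

definition recursion_operator ::
    "('a::locally_convex_space \<Rightarrow> 'a) \<Rightarrow> (real \<Rightarrow> 'a \<Rightarrow> 'a \<Rightarrow> 'a) \<Rightarrow> bool" where
  "recursion_operator K \<Phi> \<longleftrightarrow> vector_field K \<and> linear_operator \<Phi> \<and>
     (\<forall>S t u. vector_field S \<longrightarrow>
        op_time_deriv \<Phi> t u (S u) + op_gateaux \<Phi> t u (K u) (S u)
        - gateaux K u (\<Phi> t u (S u)) + \<Phi> t u (gateaux K u (S u)) = 0)"

definition hereditary :: "(real \<Rightarrow> 'a::locally_convex_space \<Rightarrow> 'a \<Rightarrow> 'a) \<Rightarrow> bool" where
  "hereditary \<Phi> \<longleftrightarrow> linear_operator \<Phi> \<and>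
     (\<forall>K S t u. vector_field K \<longrightarrow> vector_field S \<longrightarrow>
        op_gateaux \<Phi> t u (\<Phi> t u (K u)) (S u) - \<Phi> t u (op_gateaux \<Phi> t u (K u) (S u))
        - op_gateaux \<Phi> t u (\<Phi> t u (S u)) (K u) + \<Phi> t u (op_gateaux \<Phi> t u (S u) (K u)) = 0)"


section \<open>The perturbation equation\<close>

text \<open>
  The space of \<open>\<eta> = (\<eta>\<^sub>0, \<dots>, \<eta>\<^sub>N)\<close> is \<open>'e ^ 'n\<close>, where \<open>'n\<close> is a type with \<open>N + 1\<close> elements and
  \<open>ix\<close> is a bijection from \<open>'n\<close> onto \<open>{0..N}\<close>: the component with coordinate \<open>i\<close> is
  \<open>\<eta>\<close> with subscript \<open>ix i\<close>.
\<close>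

definition pert_sum ::
    "('n \<Rightarrow> nat) \<Rightarrow> real \<Rightarrow> 'e::locally_convex_space ^ 'n::finite \<Rightarrow> 'e" where
  "pert_sum ix \<epsilon> \<eta> = (\<Sum>i\<in>UNIV. \<epsilon> ^ ix i *\<^sub>R \<eta> $ i)"

definition pert_field ::
    "('n \<Rightarrow> nat) \<Rightarrow> ('e::locally_convex_space \<Rightarrow> 'e) \<Rightarrow> 'e ^ 'n::finite \<Rightarrow> 'e ^ 'n" where
  "pert_field ix K \<eta> =
     (\<chi> i. (1 / fact (ix i)) *\<^sub>R (curve_deriv ^^ ix i) (\<lambda>\<epsilon>. K (pert_sum ix \<epsilon> \<eta>)) 0)"

definition pert_block ::
    "('n \<Rightarrow> nat) \<Rightarrow> (real \<Rightarrow> 'e::locally_convex_space \<Rightarrow> 'e \<Rightarrow> 'e) \<Rightarrow>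
     real \<Rightarrow> 'e ^ 'n::finite \<Rightarrow> 'n \<Rightarrow> 'n \<Rightarrow> 'e \<Rightarrow> 'e" where
  "pert_block ix \<Phi> t \<eta> i j w =
     (if ix i < ix j then 0
      else (1 / fact (ix i - ix j)) *\<^sub>R
             (curve_deriv ^^ (ix i - ix j)) (\<lambda>\<epsilon>. \<Phi> t (pert_sum ix \<epsilon> \<eta>) w) 0)"

definition pert_op ::
    "('n \<Rightarrow> nat) \<Rightarrow> (real \<Rightarrow> 'e::locally_convex_space \<Rightarrow> 'e \<Rightarrow> 'e) \<Rightarrow>
     real \<Rightarrow> 'e ^ 'n::finite \<Rightarrow> 'e ^ 'n \<Rightarrow> 'e ^ 'n" where
  "pert_op ix \<Phi> t \<eta> \<sigma> = (\<chi> i. \<Sum>j\<in>UNIV. pert_block ix \<Phi> t \<eta> i j (\<sigma> $ j))"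

end

theory Submission
  imports Defs
begin

text \<open>
  Let \<open>u(\<epsilon>) = \<Sum>\<^sub>j \<epsilon>\<^sup>j \<eta>\<^sub>j\<close> and \<open>w(\<epsilon>) = \<Sum>\<^sub>j \<epsilon>\<^sup>j \<sigma>\<^sub>j\<close>.  By the Leibniz rule, the perturbed field at \<open>\<eta>\<close> and
  the perturbed operator at \<open>\<eta>\<close> applied to \<open>\<sigma>\<close> are the vectors of Taylor coefficients up to order \<open>N\<close>
  at \<open>\<epsilon> = 0\<close> of the curves \<open>K(u(\<epsilon>))\<close> and \<open>\<Phi>(u(\<epsilon>)) w(\<epsilon>)\<close>.  Taking Taylor coefficients commutes
  with Gateaux derivatives in \<open>\<eta>\<close> by the symmetry of second derivatives, and by the chain rule the
  Taylor coefficients of \<open>F(c(\<epsilon>))\<close> up to order \<open>N\<close> only depend on those of \<open>c\<close>, so that \<open>c\<close> may be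
  replaced by its Taylor polynomial.  Hence the left-hand side of each identity on the perturbed
  space is the vector of Taylor coefficients of the corresponding expression for \<open>K\<close> and \<open>\<Phi>\<close>
  along \<open>u(\<epsilon>)\<close>, which vanishes.

  The calculus this needs holds without any completeness assumption: it rests on the mean value
  theorem in the form that a difference quotient lies in every open convex set containing the
  derivatives.
\<close>

section \<open>Curves in locally convex spaces\<close>

instance prod :: (topological_monoid_add, topological_monoid_add) topological_monoid_add
proof
  fix a b :: "'a \<times> 'b"
  show "LIM x nhds a \<times>\<^sub>F nhds b. fst x + snd x :> nhds (a + b)"
    unfolding plus_prod_def
    by (intro tendsto_Pair tendsto_add tendsto_fst tendsto_snd filterlim_fst filterlim_snd)
qed

instance prod :: (topological_comm_monoid_add, topological_comm_monoid_add)
  topological_comm_monoid_add ..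

instance prod :: (topological_group_add, topological_group_add) topological_group_add
proof
  fix a :: "'a \<times> 'b"
  show "(uminus \<longlongrightarrow> - a) (nhds a)"
    unfolding uminus_prod_def
    by (intro tendsto_Pair tendsto_minus tendsto_fst tendsto_snd filterlim_ident)
qed

instance prod :: (topological_ab_group_add, topological_ab_group_add) topological_ab_group_add ..

instance prod :: (locally_convex_space, locally_convex_space) locally_convex_space
proof
  fix a :: real and b :: "'a \<times> 'b"
  show "((\<lambda>p. fst p *\<^sub>R snd p) \<longlongrightarrow> a *\<^sub>R b) (nhds a \<times>\<^sub>F nhds b)"
    unfolding scaleR_prod_def
    by (intro tendsto_Pair tendsto_scaleR_lcs tendsto_fst tendsto_snd filterlim_fst filterlim_snd)
next
  fix U :: "('a \<times> 'b) set"
  assume "open U" "0 \<in> U"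
  then obtain A B where AB: "open A" "open B" "0 \<in> A \<times> B" "A \<times> B \<subseteq> U"
    by (rule open_prod_elim)
  then have "0 \<in> A" "0 \<in> B"
    by (auto simp: zero_prod_def)
  obtain V where V: "open V" "convex V" "0 \<in> V" "V \<subseteq> A"
    using locally_convex_nhd[OF AB(1) \<open>0 \<in> A\<close>] by blast
  obtain W where W: "open W" "convex W" "0 \<in> W" "W \<subseteq> B"
    using locally_convex_nhd[OF AB(2) \<open>0 \<in> B\<close>] by blast
  show "\<exists>V. open V \<and> 0 \<in> V \<and> V \<subseteq> U \<and>
      (\<forall>x\<in>V. \<forall>y\<in>V. \<forall>s\<ge>0. \<forall>t\<ge>0. s + t = 1 \<longrightarrow> s *\<^sub>R x + t *\<^sub>R y \<in> V)"
  proof (intro exI[of _ "V \<times> W"] conjI)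
    show "V \<times> W \<subseteq> U" using V W AB by blast
    show "\<forall>x\<in>V \<times> W. \<forall>y\<in>V \<times> W. \<forall>s\<ge>0. \<forall>t\<ge>0. s + t = 1 \<longrightarrow> s *\<^sub>R x + t *\<^sub>R y \<in> V \<times> W"
      using V(2) W(2) by (auto simp: convex_def)
  qed (use V W in \<open>auto simp: open_Times zero_prod_def\<close>)
qed

lemma continuous_on_scaleR_lcs:
  fixes g :: "'b::topological_space \<Rightarrow> 'a::locally_convex_space"
  assumes "continuous_on S f" "continuous_on S g"
  shows "continuous_on S (\<lambda>x. f x *\<^sub>R g x)"
  using assms unfolding continuous_on_def by (blast intro: tendsto_scaleR_lcs)

lemma locally_convex_nhd_at:
  fixes U :: "'a::locally_convex_space set"
  assumes "open U" "a \<in> U"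
  obtains V where "open V" "convex V" "a \<in> V" "V \<subseteq> U"
proof -
  have "open ((\<lambda>x. x + a) -` U)"
    by (intro open_vimage assms continuous_intros)
  then obtain V where V: "open V" "convex V" "0 \<in> V" "V \<subseteq> (\<lambda>x. x + a) -` U"
    using locally_convex_nhd[of "(\<lambda>x. x + a) -` U"] assms by auto
  show ?thesis
  proof
    show "open ((\<lambda>x. x - a) -` V)"
      by (intro open_vimage V continuous_intros)
    have "(\<lambda>x. x - a) -` V = (\<lambda>x. a + x) ` V"
    proof (intro set_eqI iffI)
      fix x
      assume "x \<in> (\<lambda>x. x - a) -` V"
      then show "x \<in> (\<lambda>x. a + x) ` V"
        by (intro image_eqI[of _ _ "x - a"]) auto
    qed auto
    then show "convex ((\<lambda>x. x - a) -` V)"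
      using V(2) by (simp add: convex_translation)
  qed (use V in force)+
qed

text \<open>\<open>curve_deriv\<close> is a \<open>Lim\<close> and carries information only when the
  limit exists. The relation asserts existence and value together, so the rules of calculus are
  stated for it and turned into equations at the end.\<close>

definition has_curve_deriv :: "(real \<Rightarrow> 'a::{real_vector, t2_space}) \<Rightarrow> 'a \<Rightarrow> real \<Rightarrow> bool" where
  "has_curve_deriv c D x \<longleftrightarrow> ((\<lambda>h. (c (x + h) - c x) /\<^sub>R h) \<longlongrightarrow> D) (at 0)"

lemma has_curve_deriv_imp_eq: "has_curve_deriv c D x \<Longrightarrow> curve_deriv c x = D"
  unfolding has_curve_deriv_def curve_deriv_def by (simp add: tendsto_Lim)

lemma has_curve_deriv_imp_differentiable: "has_curve_deriv c D x \<Longrightarrow> curve_differentiable c x"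
  unfolding has_curve_deriv_def curve_differentiable_def by blast

lemma curve_differentiable_has_deriv:
  "curve_differentiable c x \<Longrightarrow> has_curve_deriv c (curve_deriv c x) x"
  using has_curve_deriv_imp_eq unfolding has_curve_deriv_def curve_differentiable_def by blast

lemma has_curve_deriv_shift:
  "has_curve_deriv (\<lambda>e. c (x + e)) D y \<longleftrightarrow> has_curve_deriv c D (x + y)"
  by (simp add: has_curve_deriv_def add.assoc)

lemma has_curve_deriv_const: "has_curve_deriv (\<lambda>_. a) 0 x"
  by (simp add: has_curve_deriv_def)

lemma has_curve_deriv_linear:
  fixes L :: "'a::locally_convex_space \<Rightarrow> 'b::locally_convex_space"
  assumes "has_curve_deriv c D x" "linear L" "continuous_on UNIV L"
  shows "has_curve_deriv (\<lambda>e. L (c e)) (L D) x"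
proof -
  have "((\<lambda>h. L ((c (x + h) - c x) /\<^sub>R h)) \<longlongrightarrow> L D) (at 0)"
    by (rule continuous_on_tendsto_compose[OF assms(3)])
      (use assms(1) in \<open>auto simp: has_curve_deriv_def\<close>)
  then show ?thesis
    using assms(2) by (simp add: has_curve_deriv_def linear_diff linear_scale)
qed

lemma has_curve_deriv_add:
  fixes c :: "real \<Rightarrow> 'a::locally_convex_space"
  assumes "has_curve_deriv c D x" "has_curve_deriv d D' x"
  shows "has_curve_deriv (\<lambda>e. c e + d e) (D + D') x"
  using tendsto_add[OF assms[unfolded has_curve_deriv_def]]
  by (simp add: has_curve_deriv_def algebra_simps)

lemma has_curve_deriv_scale:
  fixes c :: "real \<Rightarrow> 'a::locally_convex_space"
  assumes "has_curve_deriv c D x"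
  shows "has_curve_deriv (\<lambda>e. a *\<^sub>R c e) (a *\<^sub>R D) x"
  using assms
  by (rule has_curve_deriv_linear)
    (auto intro!: linearI continuous_on_scaleR_lcs continuous_intros simp: algebra_simps)

lemma has_curve_deriv_diff:
  fixes c :: "real \<Rightarrow> 'a::locally_convex_space"
  assumes "has_curve_deriv c D x" "has_curve_deriv d D' x"
  shows "has_curve_deriv (\<lambda>e. c e - d e) (D - D') x"
  using has_curve_deriv_add[OF assms(1) has_curve_deriv_scale[OF assms(2), of "- 1"]] by simp

lemma has_curve_deriv_Pair:
  assumes "has_curve_deriv c D x" "has_curve_deriv d D' x"
  shows "has_curve_deriv (\<lambda>e. (c e, d e)) (D, D') x"
  using tendsto_Pair[OF assms[unfolded has_curve_deriv_def]] by (simp add: has_curve_deriv_def)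

lemma has_curve_deriv_vec:
  fixes c :: "real \<Rightarrow> 'a::locally_convex_space ^ 'n::finite"
  assumes "\<And>i. has_curve_deriv (\<lambda>e. c e $ i) (D $ i) x"
  shows "has_curve_deriv c D x"
  unfolding has_curve_deriv_def
  by (rule vec_tendstoI) (use assms in \<open>simp add: has_curve_deriv_def\<close>)

lemma has_curve_deriv_tendsto:
  fixes c :: "real \<Rightarrow> 'a::locally_convex_space"
  assumes "has_curve_deriv c D x"
  shows "((\<lambda>h. c (x + h)) \<longlongrightarrow> c x) (at 0)"
proof -
  have "((\<lambda>h. h *\<^sub>R ((c (x + h) - c x) /\<^sub>R h) + c x) \<longlongrightarrow> 0 *\<^sub>R D + c x) (at 0)"
    by (intro tendsto_add tendsto_scaleR_lcs tendsto_const
        assms[unfolded has_curve_deriv_def] tendsto_ident_at)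
  then have "((\<lambda>h. h *\<^sub>R ((c (x + h) - c x) /\<^sub>R h) + c x) \<longlongrightarrow> c x) (at 0)"
    by simp
  then show ?thesis
    by (rule Lim_transform_eventually) (simp add: eventually_at_filter)
qed

lemma has_curve_deriv_scaleR:
  fixes c :: "real \<Rightarrow> 'a::locally_convex_space"
  assumes f: "has_curve_deriv f a x" and c: "has_curve_deriv c D x"
  shows "has_curve_deriv (\<lambda>e. f e *\<^sub>R c e) (f x *\<^sub>R D + a *\<^sub>R c x) x"
proof -
  have "((\<lambda>h. f (x + h) *\<^sub>R ((c (x + h) - c x) /\<^sub>R h) + ((f (x + h) - f x) /\<^sub>R h) *\<^sub>R c x)
      \<longlongrightarrow> f x *\<^sub>R D + a *\<^sub>R c x) (at 0)"
    by (intro tendsto_add tendsto_scaleR_lcs tendsto_const has_curve_deriv_tendsto[OF f]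
        f[unfolded has_curve_deriv_def] c[unfolded has_curve_deriv_def])
  then show ?thesis
    by (simp add: has_curve_deriv_def algebra_simps)
qed

lemma has_curve_deriv_ident: "has_curve_deriv (\<lambda>e. e) 1 x"
  unfolding has_curve_deriv_def
  by (rule Lim_transform_eventually[OF tendsto_const]) (auto simp: eventually_at_filter)

text \<open>Bisection: the claim passes from two adjacent intervals to their union, because the mean
  slope over the union is a convex combination of the two slopes, and it holds on short intervals
  around each point because the derivative there lies in the open set \<open>W\<close>. Writing the
  increment as a multiple of an element of \<open>W\<close>, instead of dividing by the length,
  keeps degenerate intervals meaningful.\<close>

lemma curve_mean_value:
  fixes c :: "real \<Rightarrow> 'a::locally_convex_space"
  assumes W: "open W" "convex W" and ab: "a \<le> b"
    and der: "\<And>s. s \<in> {a..b} \<Longrightarrow> has_curve_deriv c (c' s) s"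
    and c': "\<And>s. s \<in> {a..b} \<Longrightarrow> c' s \<in> W"
  shows "c b - c a \<in> (\<lambda>w. (b - a) *\<^sub>R w) ` W"
  using ab
proof (induction rule: Bolzano)
  case (trans p q r)
  then obtain v w where vw: "v \<in> W" "w \<in> W" "c q - c p = (q - p) *\<^sub>R v" "c r - c q = (r - q) *\<^sub>R w"
    by auto
  have "c r - c p = (c q - c p) + (c r - c q)" by simp
  then have eq: "c r - c p = (q - p) *\<^sub>R v + (r - q) *\<^sub>R w"
    unfolding vw .
  show ?case
  proof (cases "p = r")
    case True
    then have "c r - c p = (r - p) *\<^sub>R v" by simp
    then show ?thesis using vw(1) by (rule image_eqI)
  next
    case False
    with trans have pr: "r - p > 0" by simp
    have "((q - p) / (r - p)) *\<^sub>R v + ((r - q) / (r - p)) *\<^sub>R w \<in> W"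
      using trans pr vw
      by (intro convexD[OF W(2)]) (simp_all add: add_divide_distrib[symmetric])
    then show ?thesis
      by (rule image_eqI[rotated]) (use pr eq in \<open>simp add: scaleR_right_distrib\<close>)
  qed
next
  case (local x)
  then have lim: "((\<lambda>h. (c (x + h) - c x) /\<^sub>R h) \<longlongrightarrow> c' x) (at 0)" and x: "c' x \<in> W"
    using der[of x] c'[of x] by (simp_all add: has_curve_deriv_def)
  have "\<forall>\<^sub>F h in at 0. (c (x + h) - c x) /\<^sub>R h \<in> W"
    by (rule topological_tendstoD[OF lim W(1) x])
  then obtain d where d: "d > 0" "\<And>h. h \<noteq> 0 \<Longrightarrow> \<bar>h\<bar> < d \<Longrightarrow> (c (x + h) - c x) /\<^sub>R h \<in> W"
    unfolding eventually_at by (auto simp: dist_norm)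
  show ?case
  proof (intro exI[of _ d] conjI allI impI d(1))
    fix p q
    assume pq: "p \<le> x \<and> x \<le> q \<and> q - p < d"
    \<comment> \<open>The slopes from \<open>x\<close> to the two ends. If an end coincides with
      \<open>x\<close>, the slope is replaced by \<open>c' x\<close>, which lies in \<open>W\<close>
      and gives the correct increment 0.\<close>
    define v where "v = (if p = x then c' x else (c (x + (p - x)) - c x) /\<^sub>R (p - x))"
    define w where "w = (if q = x then c' x else (c (x + (q - x)) - c x) /\<^sub>R (q - x))"
    have v: "v \<in> W" "c p - c x = (p - x) *\<^sub>R v"
      using d(2)[of "p - x"] pq x by (simp_all add: v_def)
    have w: "w \<in> W" "c q - c x = (q - x) *\<^sub>R w"
      using d(2)[of "q - x"] pq x by (simp_all add: w_def)
    have "c q - c p = (c q - c x) - (c p - c x)" by simp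
    also have "\<dots> = (q - x) *\<^sub>R w + (x - p) *\<^sub>R v"
      unfolding v(2) w(2) by (simp add: algebra_simps)
    finally have eq: "c q - c p = (q - x) *\<^sub>R w + (x - p) *\<^sub>R v" .
    show "c q - c p \<in> (\<lambda>w. (q - p) *\<^sub>R w) ` W"
    proof (cases "p = q")
      case True
      then have "c q - c p = (q - p) *\<^sub>R c' x" by simp
      then show ?thesis using x by (rule image_eqI)
    next
      case False
      with pq have pr: "q - p > 0" by simp
      have "((q - x) / (q - p)) *\<^sub>R w + ((x - p) / (q - p)) *\<^sub>R v \<in> W"
        using pq pr v w
        by (intro convexD[OF W(2)]) (simp_all add: add_divide_distrib[symmetric])
      then show ?thesis
        by (rule image_eqI[rotated]) (use pr eq in \<open>simp add: scaleR_right_distrib\<close>)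
    qed
  qed
qed

lemma curve_quotient_mem:
  fixes c :: "real \<Rightarrow> 'a::locally_convex_space"
  assumes W: "open W" "convex W" and h: "h \<noteq> 0"
    and der: "\<And>s. \<bar>s\<bar> \<le> \<bar>h\<bar> \<Longrightarrow> has_curve_deriv c (c' s) s"
    and c': "\<And>s. \<bar>s\<bar> \<le> \<bar>h\<bar> \<Longrightarrow> c' s \<in> W"
  shows "(c h - c 0) /\<^sub>R h \<in> W"
proof (cases "h > 0")
  case True
  have "c h - c 0 \<in> (\<lambda>w. (h - 0) *\<^sub>R w) ` W"
    by (rule curve_mean_value[of W 0 h c c']) (use True assms in auto)
  then obtain w where "w \<in> W" "c h - c 0 = h *\<^sub>R w" by auto
  then show ?thesis using h by simp
next
  case False
  have "c 0 - c h \<in> (\<lambda>w. (0 - h) *\<^sub>R w) ` W"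
    by (rule curve_mean_value[of W h 0 c c']) (use False assms in auto)
  then obtain w where "w \<in> W" "c 0 - c h = - (h *\<^sub>R w)" by auto
  then have "w \<in> W" "c h - c 0 = h *\<^sub>R w"
    by (metis minus_diff_eq minus_minus)+
  then show ?thesis using h by simp
qed

text \<open>The source of all later limits of difference quotients. Both the curve and the step may
  vary with the index; it suffices that the derivatives on the whole interval swept by the step are
  eventually close to \<open>D\<close>. Shrinking the target neighbourhood to a convex one lets the
  mean value theorem carry this closeness over to the quotient.\<close>

lemma curve_quotients_tendsto:
  fixes g :: "'i \<Rightarrow> real \<Rightarrow> 'a::locally_convex_space"
  assumes nz: "\<forall>\<^sub>F i in F. \<rho> i \<noteq> 0"
    and der: "\<And>i r. has_curve_deriv (g i) (g' i r) r"
    and lim: "\<And>W. open W \<Longrightarrow> D \<in> W \<Longrightarrow> \<forall>\<^sub>F i in F. \<forall>r. \<bar>r\<bar> \<le> \<bar>\<rho> i\<bar> \<longrightarrow> g' i r \<in> W"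
  shows "((\<lambda>i. (g i (\<rho> i) - g i 0) /\<^sub>R \<rho> i) \<longlongrightarrow> D) F"
proof (rule topological_tendstoI)
  fix U
  assume "open U" "D \<in> U"
  then obtain W where W: "open W" "convex W" "D \<in> W" "W \<subseteq> U"
    by (rule locally_convex_nhd_at)
  show "\<forall>\<^sub>F i in F. (g i (\<rho> i) - g i 0) /\<^sub>R \<rho> i \<in> U"
    using nz lim[OF W(1,3)]
  proof eventually_elim
    case (elim i)
    have "(g i (\<rho> i) - g i 0) /\<^sub>R \<rho> i \<in> W"
      using W(1,2) elim(1) der
      by (rule curve_quotient_mem) (use elim(2) in blast)
    with W show ?case by blast
  qed
qed

text \<open>If the derivatives are values of one jointly continuous function at a convergent
  parameter, a box neighbourhood of \<open>(0, d)\<close> supplies the uniformity required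
  above.\<close>

lemma curve_quotients_tendsto_continuous:
  fixes g :: "'i \<Rightarrow> real \<Rightarrow> 'a::locally_convex_space" and q :: "'i \<Rightarrow> 'b::topological_space"
  assumes nz: "\<forall>\<^sub>F i in F. \<rho> i \<noteq> 0" and \<rho>: "(\<rho> \<longlongrightarrow> 0) F" and q: "(q \<longlongrightarrow> d) F"
    and f: "continuous_on UNIV (\<lambda>(r, b). f r b)"
    and der: "\<And>i r. has_curve_deriv (g i) (f r (q i)) r"
  shows "((\<lambda>i. (g i (\<rho> i) - g i 0) /\<^sub>R \<rho> i) \<longlongrightarrow> f 0 d) F"
proof (rule curve_quotients_tendsto[OF nz der])
  fix W
  assume W: "open W" "f 0 d \<in> W"
  have "open ((\<lambda>(r, b). f r b) -` W)"
    using W(1) f by (rule open_vimage)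
  moreover have "(0, d) \<in> (\<lambda>(r, b). f r b) -` W" using W by simp
  ultimately obtain A B where AB: "open A" "open B" "(0, d) \<in> A \<times> B"
      "A \<times> B \<subseteq> (\<lambda>(r, b). f r b) -` W"
    by (rule open_prod_elim)
  then have "0 \<in> A" by simp
  with AB(1) obtain e where e: "e > 0" "ball 0 e \<subseteq> A"
    by (rule openE)
  have "\<forall>\<^sub>F i in F. \<bar>\<rho> i\<bar> < e"
    using tendstoD[OF \<rho> e(1)] by simp
  moreover have "\<forall>\<^sub>F i in F. q i \<in> B"
    using topological_tendstoD[OF q AB(2)] AB(3) by simp
  ultimately show "\<forall>\<^sub>F i in F. \<forall>r. \<bar>r\<bar> \<le> \<bar>\<rho> i\<bar> \<longrightarrow> f r (q i) \<in> W"
  proof eventually_elim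
    case (elim i)
    show ?case
    proof (intro allI impI)
      fix r :: real
      assume "\<bar>r\<bar> \<le> \<bar>\<rho> i\<bar>"
      with elim have "r \<in> ball 0 e" by simp
      with e have "r \<in> A" by blast
      with elim have "(r, q i) \<in> A \<times> B" by simp
      with AB(4) have "(r, q i) \<in> (\<lambda>(r, b). f r b) -` W" by (rule subsetD)
      then show "f r (q i) \<in> W" by simp
    qed
  qed
qed

section \<open>Continuously differentiable maps\<close>

definition C1 :: "('a::locally_convex_space \<Rightarrow> 'b::locally_convex_space) \<Rightarrow> bool" where
  "C1 F \<longleftrightarrow> (\<forall>u v. curve_differentiable (\<lambda>e. F (u + e *\<^sub>R v)) 0) \<and>
     continuous_on UNIV (\<lambda>(u, v). gateaux F u v)"

lemma gateauxI: "has_curve_deriv (\<lambda>e. F (u + e *\<^sub>R v)) D 0 \<Longrightarrow> gateaux F u v = D"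
  unfolding gateaux_def by (rule has_curve_deriv_imp_eq)

lemma C1_has_deriv:
  assumes "C1 F"
  shows "has_curve_deriv (\<lambda>e. F (u + e *\<^sub>R v)) (gateaux F (u + r *\<^sub>R v) v) r"
proof -
  have "has_curve_deriv (\<lambda>e. F ((u + r *\<^sub>R v) + e *\<^sub>R v)) (gateaux F (u + r *\<^sub>R v) v) 0"
    using assms unfolding C1_def gateaux_def by (blast intro: curve_differentiable_has_deriv)
  then show ?thesis
    using has_curve_deriv_shift[of "\<lambda>e. F (u + e *\<^sub>R v)" r _ 0] by (simp add: algebra_simps)
qed

lemma C1_has_deriv_0:
  "C1 F \<Longrightarrow> has_curve_deriv (\<lambda>e. F (u + e *\<^sub>R v)) (gateaux F u v) 0"
  using C1_has_deriv[of F u v 0] by simp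

lemma C1_continuous_gateaux:
  assumes "C1 F" "continuous_on S f" "continuous_on S g"
  shows "continuous_on S (\<lambda>x. gateaux F (f x) (g x))"
proof -
  have "continuous_on S (\<lambda>x. case_prod (gateaux F) (f x, g x))"
    by (rule continuous_on_compose2[of UNIV "case_prod (gateaux F)"])
      (use assms in \<open>auto simp: C1_def intro: continuous_intros\<close>)
  then show ?thesis by simp
qed

text \<open>With \<open>q h\<close> the difference quotient of \<open>c\<close>, the point
  \<open>c (x + h)\<close> equals \<open>c x + h *\<^sub>R q h\<close>. The increment of
  \<open>F\<close> is thus taken along a straight line whose direction \<open>q h\<close> tends to
  \<open>D\<close>, and joint continuity of the derivative handles the moving direction.\<close>

lemma has_curve_deriv_chain:
  assumes F: "C1 F" and c: "has_curve_deriv c D x"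
  shows "has_curve_deriv (\<lambda>e. F (c e)) (gateaux F (c x) D) x"
proof -
  define q where "q h = (c (x + h) - c x) /\<^sub>R h" for h
  have "((\<lambda>h. (F (c x + h *\<^sub>R q h) - F (c x + 0 *\<^sub>R q h)) /\<^sub>R h)
      \<longlongrightarrow> gateaux F (c x + 0 *\<^sub>R D) D) (at 0)"
  proof (rule curve_quotients_tendsto_continuous[where F = "at 0" and \<rho> = "\<lambda>h. h" and q = q and d = D
      and f = "\<lambda>r b. gateaux F (c x + r *\<^sub>R b) b" and g = "\<lambda>h r. F (c x + r *\<^sub>R q h)"])
    show "\<forall>\<^sub>F h in at 0. h \<noteq> (0::real)" by (simp add: eventually_at_filter)
    show "(q \<longlongrightarrow> D) (at 0)" using c unfolding has_curve_deriv_def q_def .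
    show "continuous_on UNIV (\<lambda>(r, b). gateaux F (c x + r *\<^sub>R b) b)"
      unfolding case_prod_beta
      by (intro C1_continuous_gateaux[OF F] continuous_on_scaleR_lcs continuous_intros)
    show "has_curve_deriv (\<lambda>r. F (c x + r *\<^sub>R q h)) (gateaux F (c x + r *\<^sub>R q h) (q h)) r" for h r
      by (rule C1_has_deriv[OF F])
  qed (rule tendsto_ident_at)
  then have "((\<lambda>h. (F (c x + h *\<^sub>R q h) - F (c x)) /\<^sub>R h) \<longlongrightarrow> gateaux F (c x) D) (at 0)"
    by simp
  then show ?thesis
    unfolding has_curve_deriv_def
    by (rule Lim_transform_eventually) (simp add: eventually_at_filter q_def)
qed

lemma has_curve_deriv_reparam:
  fixes c :: "real \<Rightarrow> 'a::locally_convex_space"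
  assumes "has_curve_deriv c D 0"
  shows "has_curve_deriv (\<lambda>e. c (a * e)) (a *\<^sub>R D) 0"
proof (cases "a = 0")
  case True
  then show ?thesis by (simp add: has_curve_deriv_const)
next
  case False
  have "((\<lambda>h. a * h) \<longlongrightarrow> 0) (at 0)"
    by (rule tendsto_eq_intros refl | simp)+
  then have "filterlim (\<lambda>h. a * h) (at 0) (at 0)"
    using False by (simp add: filterlim_at eventually_at_filter)
  then have "((\<lambda>h. (c (0 + a * h) - c 0) /\<^sub>R (a * h)) \<longlongrightarrow> D) (at 0)"
    by (rule filterlim_compose[OF assms[unfolded has_curve_deriv_def]])
  from tendsto_scaleR_lcs[OF tendsto_const[of a] this] show ?thesis
    using False by (simp add: has_curve_deriv_def mult.assoc[symmetric])
qed

lemma gateaux_scaleR: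
  assumes "C1 F"
  shows "gateaux F u (a *\<^sub>R v) = a *\<^sub>R gateaux F u v"
  using has_curve_deriv_reparam[OF C1_has_deriv_0[OF assms], of u a v]
  by (intro gateauxI) (simp add: mult.commute)

text \<open>Go from \<open>u\<close> to \<open>u + h *\<^sub>R v\<close> and from there in direction
  \<open>w\<close>. The first leg contributes the derivative along \<open>v\<close>; the second has
  a moving base point, so its limit needs joint continuity of the derivative.\<close>

lemma gateaux_add:
  assumes F: "C1 F"
  shows "gateaux F u (v + w) = gateaux F u v + gateaux F u w"
proof -
  have 1: "((\<lambda>h. (F (u + h *\<^sub>R v + h *\<^sub>R w) - F (u + h *\<^sub>R v + 0 *\<^sub>R w)) /\<^sub>R h)
      \<longlongrightarrow> gateaux F (u + 0 *\<^sub>R v + 0 *\<^sub>R w) w) (at 0)"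
  proof (rule curve_quotients_tendsto_continuous[where F = "at 0" and \<rho> = "\<lambda>h. h" and q = "\<lambda>h. h" and d = 0
      and f = "\<lambda>r b. gateaux F (u + b *\<^sub>R v + r *\<^sub>R w) w" and g = "\<lambda>h r. F (u + h *\<^sub>R v + r *\<^sub>R w)"])
    show "\<forall>\<^sub>F h in at 0. h \<noteq> (0::real)" by (simp add: eventually_at_filter)
    show "continuous_on UNIV (\<lambda>(r, b). gateaux F (u + b *\<^sub>R v + r *\<^sub>R w) w)"
      unfolding case_prod_beta
      by (intro C1_continuous_gateaux[OF F] continuous_on_scaleR_lcs continuous_intros)
    show "has_curve_deriv (\<lambda>r. F (u + h *\<^sub>R v + r *\<^sub>R w)) (gateaux F (u + h *\<^sub>R v + r *\<^sub>R w) w) r" for h r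
      by (rule C1_has_deriv[OF F])
  qed (rule tendsto_ident_at)+
  have 2: "((\<lambda>h. (F (u + (0 + h) *\<^sub>R v) - F (u + 0 *\<^sub>R v)) /\<^sub>R h) \<longlongrightarrow> gateaux F u v) (at 0)"
    using C1_has_deriv_0[OF F] unfolding has_curve_deriv_def by blast
  show ?thesis
  proof (rule gateauxI)
    show "has_curve_deriv (\<lambda>e. F (u + e *\<^sub>R (v + w))) (gateaux F u v + gateaux F u w) 0"
      using tendsto_add[OF 2 1] unfolding has_curve_deriv_def scaleR_add_right[symmetric]
      by (simp add: scaleR_add_right add.assoc)
  qed
qed

lemma linear_gateaux: "C1 F \<Longrightarrow> linear (gateaux F u)"
  by (intro linearI gateaux_add gateaux_scaleR)

section \<open>Symmetry of second derivatives\<close>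

lemma continuous_at_zero2:
  fixes f :: "real \<Rightarrow> real \<Rightarrow> 'a::topological_space"
  assumes "continuous_on UNIV (\<lambda>(r, s). f r s)" "open W" "f 0 0 \<in> W"
  obtains e where "e > 0" "\<And>r s. \<bar>r\<bar> < e \<Longrightarrow> \<bar>s\<bar> < e \<Longrightarrow> f r s \<in> W"
proof -
  have "open ((\<lambda>(r, s). f r s) -` W)"
    using assms(2,1) by (rule open_vimage)
  moreover have "(0, 0) \<in> (\<lambda>(r, s). f r s) -` W"
    using assms(3) by simp
  ultimately obtain A B where AB: "open A" "open B" "(0, 0) \<in> A \<times> B"
      "A \<times> B \<subseteq> (\<lambda>(r, s). f r s) -` W"
    by (rule open_prod_elim)
  have "open (A \<inter> B)" "0 \<in> A \<inter> B"
    using AB by auto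
  then obtain e where e: "e > 0" "ball 0 e \<subseteq> A \<inter> B"
    by (rule openE)
  show thesis
  proof (rule that[OF e(1)])
    fix r s :: real
    assume "\<bar>r\<bar> < e" "\<bar>s\<bar> < e"
    then have "r \<in> ball 0 e" "s \<in> ball 0 e" by auto
    with e(2) have "(r, s) \<in> A \<times> B" by blast
    with AB(4) have "(r, s) \<in> (\<lambda>(r, s). f r s) -` W" by (rule subsetD)
    then show "f r s \<in> W" by simp
  qed
qed

text \<open>The mean value theorem is used twice. The double quotient is the quotient in
  \<open>s\<close> of \<open>g h s\<close>, itself a quotient in direction \<open>w\<close>. The
  derivative of \<open>g h\<close> in \<open>s\<close> is the quotient of
  \<open>gateaux F _ v\<close> in direction \<open>w\<close>, and a second application puts this
  near the mixed derivative, uniformly for \<open>s\<close> between \<open>- \<bar>h\<bar>\<close>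
  and \<open>\<bar>h\<bar>\<close>.\<close>

lemma second_difference_tendsto:
  assumes F: "C1 F" and G: "C1 (\<lambda>u. gateaux F u v)"
  shows "((\<lambda>h. (F (u + h *\<^sub>R w + h *\<^sub>R v) - F (u + h *\<^sub>R v) - (F (u + h *\<^sub>R w) - F u)) /\<^sub>R h /\<^sub>R h)
    \<longlongrightarrow> gateaux (\<lambda>u. gateaux F u v) u w) (at 0)"
proof -
  define G where "G = (\<lambda>u. gateaux F u v)"
  have G: "C1 G" using assms(2) by (simp add: G_def)
  define g where "g h s = (F (u + h *\<^sub>R w + s *\<^sub>R v) - F (u + s *\<^sub>R v)) /\<^sub>R h" for h s
  define g' where "g' h s = (G (u + h *\<^sub>R w + s *\<^sub>R v) - G (u + s *\<^sub>R v)) /\<^sub>R h" for h s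
  have "((\<lambda>h. (g h h - g h 0) /\<^sub>R h) \<longlongrightarrow> gateaux G u w) (at 0)"
  proof (rule curve_quotients_tendsto[where \<rho> = "\<lambda>h. h" and g' = g'])
    show "\<forall>\<^sub>F h in at 0. h \<noteq> (0::real)" by (simp add: eventually_at_filter)
    show "has_curve_deriv (g h) (g' h s) s" for h s
      unfolding g_def g'_def G_def
      by (intro has_curve_deriv_scale has_curve_deriv_diff C1_has_deriv[OF F])
    fix U
    assume "open U" "gateaux G u w \<in> U"
    then obtain W where W: "open W" "convex W" "gateaux G u w \<in> W" "W \<subseteq> U"
      by (rule locally_convex_nhd_at)
    have "continuous_on UNIV (\<lambda>(r, s). gateaux G (u + s *\<^sub>R v + r *\<^sub>R w) w)"
      unfolding case_prod_beta
      by (intro C1_continuous_gateaux[OF G] continuous_on_scaleR_lcs continuous_intros)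
    then obtain e where e: "e > 0"
        "\<And>r s. \<bar>r\<bar> < e \<Longrightarrow> \<bar>s\<bar> < e \<Longrightarrow> gateaux G (u + s *\<^sub>R v + r *\<^sub>R w) w \<in> W"
      by (rule continuous_at_zero2[OF _ W(1)]) (use W(3) in auto)
    have "\<forall>\<^sub>F h in at 0. \<bar>h\<bar> < e \<and> h \<noteq> (0::real)"
      unfolding eventually_at by (rule exI[of _ e]) (simp add: e(1))
    then show "\<forall>\<^sub>F h in at 0. \<forall>s. \<bar>s\<bar> \<le> \<bar>h\<bar> \<longrightarrow> g' h s \<in> U"
    proof eventually_elim
      case (elim h)
      show ?case
      proof (intro allI impI)
        fix s :: real
        assume s: "\<bar>s\<bar> \<le> \<bar>h\<bar>"
        \<comment> \<open>The second use of the mean value theorem: the base point is shifted along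
          \<open>v\<close> by \<open>s\<close> and the step is taken along \<open>w\<close>.\<close>
        have "(G (u + s *\<^sub>R v + h *\<^sub>R w) - G (u + s *\<^sub>R v + 0 *\<^sub>R w)) /\<^sub>R h \<in> W"
          by (rule curve_quotient_mem[OF W(1,2) conjunct2[OF elim] C1_has_deriv[OF G]])
            (use e(2) elim s in simp)
        then have "g' h s \<in> W"
          by (simp add: g'_def add_ac)
        with W(4) show "g' h s \<in> U" ..
      qed
    qed
  qed
  then show ?thesis
    by (simp add: g_def G_def scaleR_diff_right)
qed

text \<open>Both iterated derivatives are limits of the same second difference quotient.\<close>

lemma gateaux_commute:
  assumes "C1 F" "C1 (\<lambda>u. gateaux F u v)" "C1 (\<lambda>u. gateaux F u w)"
  shows "gateaux (\<lambda>u. gateaux F u v) u w = gateaux (\<lambda>u. gateaux F u w) u v"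
proof (rule tendsto_unique)
  show "((\<lambda>h. (F (u + h *\<^sub>R w + h *\<^sub>R v) - F (u + h *\<^sub>R v) - (F (u + h *\<^sub>R w) - F u)) /\<^sub>R h /\<^sub>R h)
    \<longlongrightarrow> gateaux (\<lambda>u. gateaux F u v) u w) (at 0)"
    using assms(1,2) by (rule second_difference_tendsto)
  have "F (u + h *\<^sub>R w + h *\<^sub>R v) - F (u + h *\<^sub>R v) - (F (u + h *\<^sub>R w) - F u) =
      F (u + h *\<^sub>R v + h *\<^sub>R w) - F (u + h *\<^sub>R w) - (F (u + h *\<^sub>R v) - F u)" for h
    by (simp add: algebra_simps)
  then show "((\<lambda>h. (F (u + h *\<^sub>R w + h *\<^sub>R v) - F (u + h *\<^sub>R v) - (F (u + h *\<^sub>R w) - F u)) /\<^sub>R h /\<^sub>R h)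
    \<longlongrightarrow> gateaux (\<lambda>u. gateaux F u w) u v) (at 0)"
    using second_difference_tendsto[OF assms(1,3), of u v] by (simp only:)
qed simp

section \<open>Smooth maps\<close>

lemma gateaux_iter_cong:
  "(\<And>j. j < k \<Longrightarrow> v j = v' j) \<Longrightarrow> gateaux_iter k F v = gateaux_iter k F v'"
  by (induction k) auto

lemma gateaux_iter_gateaux_iter:
  "gateaux_iter k (gateaux_iter m F v) w =
    gateaux_iter (m + k) F (\<lambda>j. if j < m then v j else w (j - m))"
proof (induction k)
  case 0
  show ?case by (auto intro: gateaux_iter_cong)
qed simp

lemma smooth_has_deriv_iter:
  assumes "smooth F"
  shows "has_curve_deriv (\<lambda>e. gateaux_iter k F v (u + e *\<^sub>R v k)) (gateaux_iter (Suc k) F v u) 0"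
  using assms unfolding smooth_def gateaux_iter.simps gateaux_def
  by (blast intro: curve_differentiable_has_deriv)

lemma smooth_continuous_iter:
  assumes F: "smooth F" and f: "continuous_on S f" and g: "\<And>j. continuous_on S (\<lambda>x. g x j)"
  shows "continuous_on S (\<lambda>x. gateaux_iter k F (g x) (f x))"
proof -
  have "continuous_on S (\<lambda>x. case_prod (\<lambda>u v. gateaux_iter k F v u) (f x, g x))"
  proof (rule continuous_on_compose2[of UNIV "case_prod (\<lambda>u v. gateaux_iter k F v u)"])
    show "continuous_on UNIV (\<lambda>(u, v). gateaux_iter k F v u)"
      using F by (simp add: smooth_def)
    show "continuous_on S (\<lambda>x. (f x, g x))"
      by (intro continuous_on_Pair f continuous_on_coordinatewise_then_product g)
  qed simp
  then show ?thesis by simp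
qed

lemma smooth_continuous: "smooth F \<Longrightarrow> continuous_on S F"
  using smooth_continuous_iter[of F S "\<lambda>x. x" "\<lambda>_ _. 0" 0] by simp

text \<open>\<open>smooth\<close> only differentiates the derivative of order \<open>k\<close> in
  direction \<open>v k\<close>. Overwriting slot \<open>k\<close> by an arbitrary \<open>w\<close>
  leaves that derivative unchanged, so every direction is covered.\<close>

lemma smooth_C1_iter:
  fixes F :: "'a::locally_convex_space \<Rightarrow> 'b::locally_convex_space"
  assumes F: "smooth F"
  shows "C1 (gateaux_iter k F v)"
proof -
  have eq: "gateaux_iter k F (v(k := w)) = gateaux_iter k F v" for w
    by (rule gateaux_iter_cong) simp
  have "curve_differentiable (\<lambda>e. gateaux_iter k F v (u + e *\<^sub>R w)) 0" for u w
    using smooth_has_deriv_iter[OF F, of k "v(k := w)" u]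
    by (intro has_curve_deriv_imp_differentiable) (simp add: eq)
  moreover have "continuous_on UNIV (\<lambda>p. gateaux_iter (Suc k) F (v(k := snd p)) (fst p))"
  proof (rule smooth_continuous_iter[OF F])
    show "continuous_on UNIV (\<lambda>p. (v(k := snd p)) j)" for j
      by (cases "j = k") (simp_all add: continuous_on_snd[OF continuous_on_id])
  qed (intro continuous_intros)
  ultimately show ?thesis
    unfolding C1_def by (simp add: eq case_prod_beta)
qed

lemma smooth_C1:
  fixes F :: "'a::locally_convex_space \<Rightarrow> 'b::locally_convex_space"
  shows "smooth F \<Longrightarrow> C1 F"
  using smooth_C1_iter[of F 0] by simp

lemma smooth_iter:
  fixes F :: "'a::locally_convex_space \<Rightarrow> 'b::locally_convex_space"
  assumes F: "smooth F"
  shows "smooth (gateaux_iter m F v)"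
  unfolding smooth_def
proof (intro conjI allI)
  fix k w u
  show "curve_differentiable (\<lambda>e. gateaux_iter k (gateaux_iter m F v) w (u + e *\<^sub>R w k)) 0"
    unfolding gateaux_iter_gateaux_iter
    using C1_has_deriv_0[OF smooth_C1_iter[OF F]]
    by (rule has_curve_deriv_imp_differentiable)
next
  fix k
  have "continuous_on UNIV (\<lambda>p. gateaux_iter (m + k) F (\<lambda>j. if j < m then v j else snd p (j - m)) (fst p))"
  proof (rule smooth_continuous_iter[OF F])
    fix j
    have "continuous_on UNIV (\<lambda>p::'a \<times> (nat \<Rightarrow> 'a). snd p (j - m))"
      by (rule continuous_on_product_then_coordinatewise) (intro continuous_intros)
    then show "continuous_on UNIV (\<lambda>p::'a \<times> (nat \<Rightarrow> 'a). if j < m then v j else snd p (j - m))"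
      by (cases "j < m") (auto intro: continuous_intros)
  qed (intro continuous_intros)
  then show "continuous_on UNIV (\<lambda>(u, w). gateaux_iter k (gateaux_iter m F v) w u)"
    unfolding gateaux_iter_gateaux_iter case_prod_beta .
qed

text \<open>The slot filled last is linear because a first derivative is linear in its direction. In
  an earlier slot the linearity identity already holds for all base points, so it can be
  differentiated once more.\<close>

lemma linear_gateaux_iter_slot:
  fixes F :: "'a::locally_convex_space \<Rightarrow> 'b::locally_convex_space"
  assumes F: "smooth F" and l: "l < m"
  shows "linear (\<lambda>w. gateaux_iter m F (v(l := w)) u)"
  using l
proof (induction m arbitrary: u)
  case (Suc m)
  have der: "has_curve_deriv (\<lambda>e. gateaux_iter m F v' (u + e *\<^sub>R d)) (gateaux (gateaux_iter m F v') u d) 0"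
    for v' d
    by (rule C1_has_deriv_0[OF smooth_C1_iter[OF F]])
  show ?case
  proof (cases "l = m")
    case True
    have "gateaux_iter m F (v(m := w)) = gateaux_iter m F v" for w
      by (rule gateaux_iter_cong) simp
    then have "(\<lambda>w. gateaux_iter (Suc m) F (v(l := w)) u) = gateaux (gateaux_iter m F v) u"
      by (intro ext) (simp add: True del: fun_upd_apply, simp)
    then show ?thesis
      using linear_gateaux[OF smooth_C1_iter[OF F, of m v], of u] by (simp only:)
  next
    case False
    with Suc.prems have "l < m" by simp
    then have IH: "linear (\<lambda>w. gateaux_iter m F (v(l := w)) x)" for x by (rule Suc.IH)
    show ?thesis
    proof (rule linearI)
      fix w w'
      have "has_curve_deriv (\<lambda>e. gateaux_iter m F (v(l := w + w')) (u + e *\<^sub>R v m))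
          (gateaux (gateaux_iter m F (v(l := w))) u (v m) + gateaux (gateaux_iter m F (v(l := w'))) u (v m)) 0"
        using has_curve_deriv_add[OF der der] by (simp add: linear_add[OF IH])
      then show "gateaux_iter (Suc m) F (v(l := w + w')) u =
          gateaux_iter (Suc m) F (v(l := w)) u + gateaux_iter (Suc m) F (v(l := w')) u"
        using False by (simp add: gateauxI)
    next
      fix a w
      have "has_curve_deriv (\<lambda>e. gateaux_iter m F (v(l := a *\<^sub>R w)) (u + e *\<^sub>R v m))
          (a *\<^sub>R gateaux (gateaux_iter m F (v(l := w))) u (v m)) 0"
        using has_curve_deriv_scale[OF der] by (simp add: linear_scale[OF IH])
      then show "gateaux_iter (Suc m) F (v(l := a *\<^sub>R w)) u = a *\<^sub>R gateaux_iter (Suc m) F (v(l := w)) u"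
        using False by (simp add: gateauxI)
    qed
  qed
qed simp

text \<open>Sequences of directions carry the product topology, so their convergence is checked one
  slot at a time.\<close>

lemma tendsto_fun:
  fixes f :: "'i \<Rightarrow> 'j \<Rightarrow> 'a::topological_space"
  assumes "\<And>j. ((\<lambda>x. f x j) \<longlongrightarrow> l j) F"
  shows "(f \<longlongrightarrow> l) F"
proof -
  have "limitin (product_topology (\<lambda>_. euclidean) UNIV) f l F"
    using assms by (simp add: limitin_componentwise)
  then show ?thesis
    by (simp add: euclidean_product_topology)
qed

text \<open>Product rule for the multilinear map \<open>D\<^sup>m F(u)[v 0, \<dots>, v (m - 1)]\<close> along curves of base points and
  directions, obtained by exchanging one direction at a time.\<close>

lemma has_curve_deriv_gateaux_iter:
  fixes F :: "'a::locally_convex_space \<Rightarrow> 'b::locally_convex_space"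
  assumes F: "smooth F" and c: "has_curve_deriv c c' x"
    and g: "\<And>l. has_curve_deriv (g l) (g' l) x"
  shows "has_curve_deriv (\<lambda>e. gateaux_iter m F (\<lambda>l. g l e) (c e))
    (gateaux_iter (Suc m) F ((\<lambda>l. g l x)(m := c')) (c x)
      + (\<Sum>p<m. gateaux_iter m F ((\<lambda>l. g l x)(p := g' p)) (c x))) x"
proof -
  \<comment> \<open>In \<open>v p h\<close> the first \<open>p\<close> directions have moved to
    parameter \<open>x + h\<close> and the others are still at \<open>x\<close>.
    \<open>M p h\<close> has its base point moved as well, so \<open>M 0 h\<close> differs from
    \<open>M 0 0\<close> in the base point only, and \<open>M (Suc p) h\<close> from
    \<open>M p h\<close> in slot \<open>p\<close> only.\<close>
  define v where "v p h l = (if l < p then g l (x + h) else g l x)" for p h l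
  define M where "M p h = gateaux_iter m F (v p h) (c (x + h))" for p h
  have v0: "v p 0 = (\<lambda>l. g l x)" "v 0 h = (\<lambda>l. g l x)" for p h
    by (auto simp: v_def)
  have M0: "M p 0 = gateaux_iter m F (\<lambda>l. g l x) (c x)" for p
    by (simp add: M_def v0)
  have tend: "((\<lambda>h. v p h l) \<longlongrightarrow> g l x) (at 0)" for p l
    unfolding v_def by (cases "l < p") (simp_all add: has_curve_deriv_tendsto[OF g])
  have D0: "((\<lambda>h. (M 0 h - M 0 0) /\<^sub>R h) \<longlongrightarrow> gateaux_iter (Suc m) F ((\<lambda>l. g l x)(m := c')) (c x)) (at 0)"
  proof -
    have "gateaux_iter m F ((\<lambda>l. g l x)(m := c')) = gateaux_iter m F (\<lambda>l. g l x)"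
      by (rule gateaux_iter_cong) simp
    then show ?thesis
      using has_curve_deriv_chain[OF smooth_C1_iter[OF F, of m "\<lambda>l. g l x"] c]
      by (simp add: has_curve_deriv_def M_def v0)
  qed
  have Dp: "((\<lambda>h. (M (Suc p) h - M p h) /\<^sub>R h) \<longlongrightarrow> gateaux_iter m F ((\<lambda>l. g l x)(p := g' p)) (c x)) (at 0)"
    if p: "p < m" for p
  proof -
    \<comment> \<open>By linearity in slot \<open>p\<close>, the quotient of
      \<open>M (Suc p) h - M p h\<close> by \<open>h\<close> is one derivative with the difference
      quotient of \<open>g p\<close> in that slot. Its limit then follows from joint
      continuity.\<close>
    define q where "q h = (v p h)(p := (g p (x + h) - g p x) /\<^sub>R h)" for h
    have "((\<lambda>h. q h l) \<longlongrightarrow> ((\<lambda>l. g l x)(p := g' p)) l) (at 0)" for l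
      using tend[of p l] g[of p, unfolded has_curve_deriv_def] by (simp add: q_def)
    then have "((\<lambda>h. (c (x + h), q h)) \<longlongrightarrow> (c x, (\<lambda>l. g l x)(p := g' p))) (at 0)"
      by (intro tendsto_Pair has_curve_deriv_tendsto[OF c])
        (rule tendsto_fun)
    moreover have "continuous_on UNIV (\<lambda>(u, v). gateaux_iter m F v u)"
      using F by (simp add: smooth_def)
    ultimately have "((\<lambda>h. gateaux_iter m F (q h) (c (x + h))) \<longlongrightarrow>
        gateaux_iter m F ((\<lambda>l. g l x)(p := g' p)) (c x)) (at 0)"
      using continuous_on_tendsto_compose[of UNIV "\<lambda>(u, v). gateaux_iter m F v u"] by fastforce
    moreover have "gateaux_iter m F (q h) (c (x + h)) = (M (Suc p) h - M p h) /\<^sub>R h" for h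
    proof -
      have lin: "linear (\<lambda>w. gateaux_iter m F ((v p h)(p := w)) (c (x + h)))"
        by (rule linear_gateaux_iter_slot[OF F p])
      have "v (Suc p) h = (v p h)(p := g p (x + h))" "v p h = (v p h)(p := g p x)"
        by (auto simp: v_def fun_eq_iff)
      then show ?thesis
        using linear_scale[OF lin] linear_diff[OF lin]
        unfolding q_def M_def by metis
    qed
    ultimately show ?thesis by simp
  qed
  have "((\<lambda>h. (M 0 h - M 0 0) /\<^sub>R h + (\<Sum>p<m. (M (Suc p) h - M p h) /\<^sub>R h)) \<longlongrightarrow>
      gateaux_iter (Suc m) F ((\<lambda>l. g l x)(m := c')) (c x)
      + (\<Sum>p<m. gateaux_iter m F ((\<lambda>l. g l x)(p := g' p)) (c x))) (at 0)"
    by (intro tendsto_add D0 tendsto_sum Dp) simp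
  moreover have "(M 0 h - M 0 0) /\<^sub>R h + (\<Sum>p<m. (M (Suc p) h - M p h) /\<^sub>R h) =
      (gateaux_iter m F (\<lambda>l. g l (x + h)) (c (x + h)) - gateaux_iter m F (\<lambda>l. g l x) (c x)) /\<^sub>R h" for h
  proof -
    have "gateaux_iter m F (\<lambda>l. g l (x + h)) (c (x + h)) = M m h"
      unfolding M_def v_def by (rule fun_cong[OF gateaux_iter_cong]) simp
    then show ?thesis
      by (simp add: scaleR_right.sum[symmetric] sum_lessThan_telescope[of "\<lambda>p. M p h"] scaleR_add_right[symmetric] M0)
  qed
  ultimately show ?thesis
    unfolding has_curve_deriv_def by simp
qed

text \<open>A family of maps of the base point and the sequence of directions that is closed under
  differentiation contains all iterated derivatives of its members.\<close>

lemma smooth_classI: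
  fixes F :: "'a::locally_convex_space \<Rightarrow> 'b::locally_convex_space"
    and C :: "('a \<Rightarrow> (nat \<Rightarrow> 'a) \<Rightarrow> 'b) set"
  assumes F: "(\<lambda>u v. F u) \<in> C"
    and cont: "\<And>f. f \<in> C \<Longrightarrow> continuous_on UNIV (\<lambda>(u, v). f u v)"
    and der: "\<And>f k. f \<in> C \<Longrightarrow>
      \<exists>f'\<in>C. \<forall>u v. has_curve_deriv (\<lambda>e. f (u + e *\<^sub>R v k) v) (f' u v) 0"
  shows "smooth F"
proof -
  have iter: "\<exists>f\<in>C. \<forall>u v. gateaux_iter k F v u = f u v" for k
  proof (induction k)
    case 0
    show ?case using F by (intro bexI) auto
  next
    case (Suc k)
    then obtain f where f: "f \<in> C" "\<And>v. gateaux_iter k F v = (\<lambda>u. f u v)" by fastforce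
    then obtain f' where "f' \<in> C" "\<forall>u v. has_curve_deriv (\<lambda>e. f (u + e *\<^sub>R v k) v) (f' u v) 0"
      using der by blast
    then show ?case
      by (intro bexI[of _ f']) (auto simp: f(2) gateauxI)
  qed
  show ?thesis
    unfolding smooth_def
  proof (intro conjI allI)
    fix k v u
    obtain f where f: "f \<in> C" "\<And>v. gateaux_iter k F v = (\<lambda>u. f u v)"
      using iter[of k] by fastforce
    then show "curve_differentiable (\<lambda>e. gateaux_iter k F v (u + e *\<^sub>R v k)) 0"
      using der[OF f(1), of k] by (auto intro: has_curve_deriv_imp_differentiable)
    show "continuous_on UNIV (\<lambda>(u, v). gateaux_iter k F v u)"
      using cont[OF f(1)] by (simp add: f(2))
  qed
qed

section \<open>Smoothness of linear maps, scalar multiplication and pairs\<close>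

lemma has_curve_deriv_affine:
  fixes a b :: "'a::locally_convex_space"
  shows "has_curve_deriv (\<lambda>e. a + e *\<^sub>R b) b x"
proof -
  have "has_curve_deriv (\<lambda>e. a + e *\<^sub>R b) (0 + (x *\<^sub>R 0 + 1 *\<^sub>R b)) x"
    by (intro has_curve_deriv_add has_curve_deriv_scaleR has_curve_deriv_const has_curve_deriv_ident)
  then show ?thesis by simp
qed

lemma continuous_on_direction:
  "continuous_on UNIV (\<lambda>p::'b::topological_space \<times> (nat \<Rightarrow> 'a::topological_space). snd p k)"
  by (rule continuous_on_product_then_coordinatewise) (intro continuous_intros)

lemma smooth_linear:
  fixes L :: "'a::locally_convex_space \<Rightarrow> 'b::locally_convex_space"
  assumes L: "linear L" "continuous_on UNIV L"
  shows "smooth L"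
proof (rule smooth_classI)
  \<comment> \<open>The derivative of \<open>L\<close> along \<open>v k\<close> is
    \<open>L (v k)\<close>, which does not depend on \<open>u\<close>; all further derivatives are
    0.\<close>
  let ?C = "{\<lambda>u v. L u} \<union> range (\<lambda>k u v. L (v k)) \<union> {\<lambda>u (v :: nat \<Rightarrow> 'a). 0}"
  show "(\<lambda>u v. L u) \<in> ?C" by simp
  have "continuous_on UNIV (\<lambda>p::'a \<times> (nat \<Rightarrow> 'a). L (fst p))"
    "continuous_on UNIV (\<lambda>p::'a \<times> (nat \<Rightarrow> 'a). L (snd p k))" for k
    by (auto intro!: continuous_on_compose2[OF L(2)] continuous_on_direction continuous_intros)
  then show "f \<in> ?C \<Longrightarrow> continuous_on UNIV (\<lambda>(u, v). f u v)" for f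
    by (auto simp: case_prod_beta)
  show "\<exists>f'\<in>?C. \<forall>u v. has_curve_deriv (\<lambda>e. f (u + e *\<^sub>R v k) v) (f' u v) 0" if "f \<in> ?C" for f k
  proof (cases "f = (\<lambda>u v. L u)")
    case True
    then show ?thesis
      by (intro bexI[of _ "\<lambda>u v. L (v k)"])
        (auto intro!: has_curve_deriv_linear[OF has_curve_deriv_affine L])
  next
    case False
    with that show ?thesis
      by (intro bexI[of _ "\<lambda>u v. 0"]) (auto intro: has_curve_deriv_const)
  qed
qed

lemma smooth_const:
  fixes b :: "'b::locally_convex_space"
  shows "smooth (\<lambda>_::'a::locally_convex_space. b)"
proof (rule smooth_classI)
  let ?C = "range (\<lambda>b (u::'a) (v::nat \<Rightarrow> 'a). b::'b)"
  show "(\<lambda>u v. b) \<in> ?C" by simp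
  show "\<exists>f'\<in>?C. \<forall>u v. has_curve_deriv (\<lambda>e. f (u + e *\<^sub>R v k) v) (f' u v) 0" if "f \<in> ?C" for f k
    using that by (intro bexI[of _ "\<lambda>u v. 0"]) (auto intro: has_curve_deriv_const)
qed auto

lemma smooth_scaleR_pair:
  "smooth (\<lambda>u::real \<times> 'a::locally_convex_space. fst u *\<^sub>R snd u)"
proof (rule smooth_classI)
  let ?B = "\<lambda>u v. fst u *\<^sub>R snd (v::real \<times> 'a)"
  \<comment> \<open>A bilinear map produces only four kinds of terms: itself, its first derivatives,
    its second derivatives, which are constant in \<open>u\<close>, and 0.\<close>
  let ?C = "{\<lambda>u v. ?B u u} \<union> range (\<lambda>k u v. ?B u (v k) + ?B (v k) u)
    \<union> (\<lambda>(k, j) u v. ?B (v k) (v j) + ?B (v j) (v k)) ` UNIV \<union> {\<lambda>u (v :: nat \<Rightarrow> real \<times> 'a). 0}"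
  show "(\<lambda>u v. ?B u u) \<in> ?C" by simp
  show "continuous_on UNIV (\<lambda>(u, v). f u v)" if "f \<in> ?C" for f
    using that unfolding case_prod_beta
    by (auto intro!: continuous_on_scaleR_lcs continuous_intros continuous_on_direction)
  have B: "has_curve_deriv (\<lambda>e. ?B (a + e *\<^sub>R b) (c + e *\<^sub>R d)) (?B a d + ?B b c) 0"
    for a b c d :: "real \<times> 'a"
    using has_curve_deriv_scaleR[OF has_curve_deriv_affine[of "fst a" "fst b" 0]
        has_curve_deriv_affine[of "snd c" "snd d" 0]] by simp
  have B0: "has_curve_deriv (\<lambda>e. ?B (a + e *\<^sub>R b) c) (?B b c) 0"
    "has_curve_deriv (\<lambda>e. ?B c (a + e *\<^sub>R b)) (?B c b) 0" for a b c :: "real \<times> 'a"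
    using B[of a b c 0] B[of c 0 a b] by simp_all
  show "\<exists>f'\<in>?C. \<forall>u v. has_curve_deriv (\<lambda>e. f (u + e *\<^sub>R v k) v) (f' u v) 0" if "f \<in> ?C" for f k
    using that
  proof (elim UnE)
    assume "f \<in> {\<lambda>u v. ?B u u}"
    then show ?thesis
      by (intro bexI[of _ "\<lambda>u v. ?B u (v k) + ?B (v k) u"]) (use B in auto)
  next
    assume "f \<in> range (\<lambda>k u v. ?B u (v k) + ?B (v k) u)"
    then obtain j where "f = (\<lambda>u v. ?B u (v j) + ?B (v j) u)" by auto
    then show ?thesis
      by (intro bexI[of _ "\<lambda>u v. ?B (v k) (v j) + ?B (v j) (v k)"])
        (use has_curve_deriv_add[OF B0] in auto)
  next
    assume "f \<in> (\<lambda>(k, j) u v. ?B (v k) (v j) + ?B (v j) (v k)) ` UNIV"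
    then show ?thesis
      by (intro bexI[of _ "\<lambda>u v. 0"]) (auto intro: has_curve_deriv_const)
  next
    assume "f \<in> {\<lambda>u v. 0}"
    then show ?thesis
      by (intro bexI[of _ "\<lambda>u v. 0"]) (auto intro: has_curve_deriv_const)
  qed
qed

text \<open>The closed families below contain derivatives that use an arbitrary selection of the
  given directions, recorded by \<beta>. Differentiating along \<open>v k\<close> raises the order
  to \<open>Suc m\<close> and enters \<open>k\<close> at place \<open>m\<close> of the
  selection.\<close>

lemma smooth_has_deriv_reindexed:
  fixes F :: "'a::locally_convex_space \<Rightarrow> 'b::locally_convex_space"
  assumes "smooth F"
  shows "has_curve_deriv (\<lambda>e. gateaux_iter m F (\<lambda>j. v (\<beta> j)) (u + e *\<^sub>R v k))
    (gateaux_iter (Suc m) F (\<lambda>j. v ((\<beta>(m := k)) j)) u) 0"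
proof -
  have "gateaux_iter m F (\<lambda>j. v ((\<beta>(m := k)) j)) = gateaux_iter m F (\<lambda>j. v (\<beta> j))"
    by (rule gateaux_iter_cong) simp
  then show ?thesis
    using smooth_has_deriv_iter[OF assms, of m "\<lambda>j. v ((\<beta>(m := k)) j)" u]
    by (simp only: fun_upd_same)
qed

lemma smooth_continuous_reindexed:
  fixes \<beta> :: "nat \<Rightarrow> nat"
  assumes "smooth F"
  shows "continuous_on UNIV (\<lambda>p. gateaux_iter m F (\<lambda>j. snd p (\<beta> j)) (fst p))"
  by (intro smooth_continuous_iter[OF assms] continuous_on_direction continuous_intros)

lemma smooth_Pair:
  fixes F :: "'z::locally_convex_space \<Rightarrow> 'a::locally_convex_space"
    and G :: "'z \<Rightarrow> 'b::locally_convex_space"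
  assumes F: "smooth F" and G: "smooth G"
  shows "smooth (\<lambda>z. (F z, G z))"
proof (rule smooth_classI)
  let ?f = "\<lambda>m \<beta> u v. (gateaux_iter m F (\<lambda>j::nat. v (\<beta> j :: nat)) u, gateaux_iter m G (\<lambda>j. v (\<beta> j)) u)"
  let ?C = "range (\<lambda>(m, \<beta>). ?f m \<beta>)"
  show "(\<lambda>u v. (F u, G u)) \<in> ?C"
    by (rule image_eqI[of _ _ "(0, id)"]) auto
  show "continuous_on UNIV (\<lambda>(u, v). f u v)" if "f \<in> ?C" for f
    using that
    by (auto simp: case_prod_beta intro!: continuous_on_Pair smooth_continuous_reindexed F G)
  show "\<exists>f'\<in>?C. \<forall>u v. has_curve_deriv (\<lambda>e. f (u + e *\<^sub>R v k) v) (f' u v) 0" if "f \<in> ?C" for f k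
  proof -
    from that obtain p where "f = (\<lambda>(m, \<beta>). ?f m \<beta>) p" by (rule rangeE)
    then obtain m \<beta> where f: "f = ?f m \<beta>" by (cases p) simp
    have "\<forall>u v. has_curve_deriv (\<lambda>e. f (u + e *\<^sub>R v k) v) (?f (Suc m) (\<beta>(m := k)) u v) 0"
      unfolding f by (intro allI has_curve_deriv_Pair smooth_has_deriv_reindexed F G)
    moreover have "?f (Suc m) (\<beta>(m := k)) \<in> ?C"
      by (rule image_eqI[of _ _ "(Suc m, \<beta>(m := k))"]) auto
    ultimately show ?thesis by (rule bexI)
  qed
qed

section \<open>Composition of smooth maps\<close>

text \<open>The maps occurring in the iterated derivatives of \<open>z \<mapsto> D\<^sup>m F(G z)[g\<^sub>0 z, g\<^sub>1 z, \<dots>]\<close>.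
  The function \<open>\<beta>\<close> records which of the given directions are used.\<close>

inductive_set iter_terms ::
    "('a::locally_convex_space \<Rightarrow> 'b::locally_convex_space) \<Rightarrow> ('z::locally_convex_space \<Rightarrow> 'a) \<Rightarrow>
      ('z \<Rightarrow> (nat \<Rightarrow> 'z) \<Rightarrow> 'b) set"
  for F :: "'a::locally_convex_space \<Rightarrow> 'b::locally_convex_space"
    and G :: "'z::locally_convex_space \<Rightarrow> 'a" where
  base: "(\<And>l. smooth (\<gamma> l)) \<Longrightarrow>
    (\<lambda>u v. gateaux_iter m F (\<lambda>l. gateaux_iter (\<kappa> l) (\<gamma> l) (\<lambda>j. v (\<beta> l j)) u) (G u)) \<in> iter_terms F G"
| zero: "(\<lambda>u v. 0) \<in> iter_terms F G"
| add: "f \<in> iter_terms F G \<Longrightarrow> g \<in> iter_terms F G \<Longrightarrow> (\<lambda>u v. f u v + g u v) \<in> iter_terms F G"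

lemma iter_terms_sum:
  "(\<And>i. i \<in> I \<Longrightarrow> f i \<in> iter_terms F G) \<Longrightarrow> (\<lambda>u v. \<Sum>i\<in>I. f i u v) \<in> iter_terms F G"
  by (induction I rule: infinite_finite_induct) (auto intro: iter_terms.intros)

lemma iter_terms_continuous:
  assumes F: "smooth F" and G: "smooth G" and f: "f \<in> iter_terms F G"
  shows "continuous_on UNIV (\<lambda>(u, v). f u v)"
  using f
proof induction
  case (base \<gamma> m \<kappa> \<beta>)
  then show ?case
    unfolding case_prod_beta
    by (intro smooth_continuous_iter[OF F] smooth_continuous_iter[OF base]
        continuous_on_compose2[OF smooth_continuous[OF G]] continuous_on_direction continuous_intros) auto
next
  case (add f g)
  then show ?case by (auto simp: case_prod_beta intro: continuous_on_add)
qed auto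

text \<open>The product rule turns a base term into a sum of base terms, one from moving the base
  point and one from each direction.\<close>

lemma iter_terms_deriv:
  assumes F: "smooth F" and G: "smooth G" and f: "f \<in> iter_terms F G"
  shows "\<exists>f'\<in>iter_terms F G. \<forall>u v. has_curve_deriv (\<lambda>e. f (u + e *\<^sub>R v k) v) (f' u v) 0"
  using f
proof induction
  case (base \<gamma> m \<kappa> \<beta>)
  define g where "g v l u = gateaux_iter (\<kappa> l) (\<gamma> l) (\<lambda>j. v (\<beta> l j)) u" for v l u
  define g' where "g' v l u = gateaux_iter (Suc (\<kappa> l)) (\<gamma> l) (\<lambda>j. v (((\<beta> l)(\<kappa> l := k)) j)) u" for v l u
  \<comment> \<open>\<open>A\<close> comes from the base point \<open>G u\<close>: the new slot
    \<open>m\<close> receives the derivative of \<open>G\<close>, which has the required form with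
    \<open>G\<close> as the map in slot \<open>m\<close> and order 1. \<open>B p\<close> comes from
    slot \<open>p\<close>, whose order rises by one.\<close>
  define A where "A u v = gateaux_iter (Suc m) F ((\<lambda>l. g v l u)(m := gateaux G u (v k))) (G u)" for u v
  define B where "B p u v = gateaux_iter m F ((\<lambda>l. g v l u)(p := g' v p u)) (G u)" for p u v
  have "has_curve_deriv (\<lambda>e. gateaux_iter m F (\<lambda>l. g v l (u + e *\<^sub>R v k)) (G (u + e *\<^sub>R v k)))
      (A u v + (\<Sum>p<m. B p u v)) 0" for u v
  proof -
    have g: "has_curve_deriv (\<lambda>e. g v l (u + e *\<^sub>R v k)) (g' v l u) 0" for l
      unfolding g_def g'_def by (rule smooth_has_deriv_reindexed[OF base])
    show ?thesis
      using has_curve_deriv_gateaux_iter[OF F C1_has_deriv_0[OF smooth_C1[OF G], of u "v k"],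
          of "\<lambda>l e. g v l (u + e *\<^sub>R v k)" "\<lambda>l. g' v l u" m] g
      by (simp add: A_def B_def del: gateaux_iter.simps)
  qed
  moreover have "A \<in> iter_terms F G"
  proof -
    have "A = (\<lambda>u v. gateaux_iter (Suc m) F (\<lambda>l. gateaux_iter ((\<kappa>(m := 1)) l) ((\<gamma>(m := G)) l)
        (\<lambda>j. v ((\<beta>(m := (\<lambda>_. k))) l j)) u) (G u))"
      unfolding A_def by (intro ext arg_cong[where f = "\<lambda>v. gateaux_iter (Suc m) F v _"]) (auto simp: g_def)
    then show ?thesis
      using iter_terms.base[of "\<gamma>(m := G)" "Suc m" F "\<kappa>(m := 1)" "\<beta>(m := (\<lambda>_. k))" G] base G by simp
  qed
  moreover have "B p \<in> iter_terms F G" for p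
  proof -
    have "B p = (\<lambda>u v. gateaux_iter m F (\<lambda>l. gateaux_iter ((\<kappa>(p := Suc (\<kappa> p))) l) (\<gamma> l)
        (\<lambda>j. v ((\<beta>(p := (\<beta> p)(\<kappa> p := k))) l j)) u) (G u))"
      unfolding B_def by (intro ext arg_cong[where f = "\<lambda>v. gateaux_iter m F v _"]) (auto simp: g_def g'_def)
    then show ?thesis
      using iter_terms.base[of \<gamma> m F "\<kappa>(p := Suc (\<kappa> p))" "\<beta>(p := (\<beta> p)(\<kappa> p := k))" G] base by simp
  qed
  ultimately show ?case
    by (intro bexI[of _ "\<lambda>u v. A u v + (\<Sum>p<m. B p u v)"] iter_terms.add iter_terms_sum)
      (auto simp: g_def)
next
  case (add f g)
  then obtain f' g' where fg': "f' \<in> iter_terms F G" "g' \<in> iter_terms F G"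
    and f': "\<And>u v. has_curve_deriv (\<lambda>e. f (u + e *\<^sub>R v k) v) (f' u v) 0"
    and g': "\<And>u v. has_curve_deriv (\<lambda>e. g (u + e *\<^sub>R v k) v) (g' u v) 0"
    by blast
  from fg' have "(\<lambda>u v. f' u v + g' u v) \<in> iter_terms F G" by (rule iter_terms.add)
  then show ?case
    by (rule bexI[rotated]) (intro allI has_curve_deriv_add f' g')
qed (auto intro: iter_terms.zero has_curve_deriv_const)

text \<open>Differentiating \<open>F (G z)\<close> creates derivatives of \<open>F\<close> whose
  directions depend on \<open>z\<close>, so closure is proved for this larger class. Orders 0 and 1
  give the rules for composition and for Gateaux derivatives.\<close>

lemma smooth_gateaux_iter:
  fixes F :: "'a::locally_convex_space \<Rightarrow> 'b::locally_convex_space"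
    and G :: "'z::locally_convex_space \<Rightarrow> 'a"
  assumes F: "smooth F" and G: "smooth G" and g: "\<And>l. smooth (g l)"
  shows "smooth (\<lambda>z. gateaux_iter m F (\<lambda>l. g l z) (G z))"
proof (rule smooth_classI)
  show "(\<lambda>u v. gateaux_iter m F (\<lambda>l. g l u) (G u)) \<in> iter_terms F G"
    using iter_terms.base[of g m F "\<lambda>_. 0" "\<lambda>_ _. 0" G] g by simp
qed (use iter_terms_continuous iter_terms_deriv F G in blast)+

lemma smooth_compose:
  fixes F :: "'a::locally_convex_space \<Rightarrow> 'b::locally_convex_space"
    and G :: "'z::locally_convex_space \<Rightarrow> 'a"
  assumes "smooth F" "smooth G"
  shows "smooth (\<lambda>z. F (G z))"
  using smooth_gateaux_iter[OF assms, of "\<lambda>_ _. 0" 0] by (simp add: smooth_const)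

lemma smooth_gateaux:
  fixes F :: "'a::locally_convex_space \<Rightarrow> 'b::locally_convex_space"
    and G g :: "'z::locally_convex_space \<Rightarrow> 'a"
  assumes "smooth F" "smooth G" "smooth g"
  shows "smooth (\<lambda>z. gateaux F (G z) (g z))"
  using smooth_gateaux_iter[OF assms(1,2), of "\<lambda>_. g" 1] assms(3) by simp

section \<open>Closure rules for smooth maps\<close>

lemma smooth_fst: "smooth (fst :: 'a::locally_convex_space \<times> 'b::locally_convex_space \<Rightarrow> 'a)"
  by (intro smooth_linear linearI continuous_intros) auto

lemma smooth_snd: "smooth (snd :: 'a::locally_convex_space \<times> 'b::locally_convex_space \<Rightarrow> 'b)"
  by (intro smooth_linear linearI continuous_intros) auto

lemma smooth_ident: "smooth (\<lambda>z::'a::locally_convex_space. z)"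
  by (intro smooth_linear linearI continuous_intros) auto

lemma smooth_vec_nth: "smooth (\<lambda>z::'a::locally_convex_space ^ 'n::finite. z $ i)"
  by (intro smooth_linear linearI continuous_intros) auto

lemma smooth_scaleR:
  fixes F :: "'z::locally_convex_space \<Rightarrow> 'a::locally_convex_space"
  assumes "smooth f" "smooth F"
  shows "smooth (\<lambda>z. f z *\<^sub>R F z)"
  using smooth_compose[OF smooth_scaleR_pair smooth_Pair[OF assms]] by simp

lemma smooth_add:
  fixes F :: "'z::locally_convex_space \<Rightarrow> 'a::locally_convex_space"
  assumes "smooth F" "smooth G"
  shows "smooth (\<lambda>z. F z + G z)"
proof -
  have "smooth (\<lambda>u::'a \<times> 'a. fst u + snd u)"
    by (intro smooth_linear linearI continuous_intros) (auto simp: algebra_simps)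
  from smooth_compose[OF this smooth_Pair[OF assms]] show ?thesis by simp
qed

lemma smooth_diff:
  fixes F :: "'z::locally_convex_space \<Rightarrow> 'a::locally_convex_space"
  assumes "smooth F" "smooth G"
  shows "smooth (\<lambda>z. F z - G z)"
  using smooth_add[OF assms(1) smooth_scaleR[OF smooth_const assms(2)], of "- 1"] by simp

lemma smooth_sum:
  fixes F :: "'i \<Rightarrow> 'z::locally_convex_space \<Rightarrow> 'a::locally_convex_space"
  assumes "\<And>i. i \<in> I \<Longrightarrow> smooth (F i)"
  shows "smooth (\<lambda>z. \<Sum>i\<in>I. F i z)"
  using assms by (induction I rule: infinite_finite_induct) (auto intro: smooth_const smooth_add)

lemma smooth_power:
  fixes f :: "'z::locally_convex_space \<Rightarrow> real"
  assumes "smooth f"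
  shows "smooth (\<lambda>z. f z ^ k)"
proof (induction k)
  case (Suc k)
  then show ?case using smooth_scaleR[OF assms, of "\<lambda>z. f z ^ k"] by simp
qed (simp add: smooth_const)

lemma smooth_vec:
  fixes F :: "'n::finite \<Rightarrow> 'z::locally_convex_space \<Rightarrow> 'a::locally_convex_space"
  assumes F: "\<And>i. smooth (F i)"
  shows "smooth (\<lambda>z. \<chi> i. F i z)"
proof (rule smooth_classI)
  let ?f = "\<lambda>m \<beta> u v. \<chi> i. gateaux_iter m (F i) (\<lambda>j::nat. v (\<beta> j :: nat)) u"
  let ?C = "range (\<lambda>(m, \<beta>). ?f m \<beta>)"
  show "(\<lambda>u v. \<chi> i. F i u) \<in> ?C"
    by (rule image_eqI[of _ _ "(0, id)"]) auto
  show "continuous_on UNIV (\<lambda>(u, v). f u v)" if "f \<in> ?C" for f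
    using that
    by (auto simp: case_prod_beta intro!: continuous_on_vec_lambda smooth_continuous_reindexed F)
  show "\<exists>f'\<in>?C. \<forall>u v. has_curve_deriv (\<lambda>e. f (u + e *\<^sub>R v k) v) (f' u v) 0" if "f \<in> ?C" for f k
  proof -
    from that obtain p where "f = (\<lambda>(m, \<beta>). ?f m \<beta>) p" by (rule rangeE)
    then obtain m \<beta> where f: "f = ?f m \<beta>" by (cases p) simp
    have "has_curve_deriv (\<lambda>e. f (u + e *\<^sub>R v k) v) (?f (Suc m) (\<beta>(m := k)) u v) 0" for u v
      unfolding f
      by (rule has_curve_deriv_vec) (simp only: vec_lambda_beta smooth_has_deriv_reindexed[OF F])
    moreover have "?f (Suc m) (\<beta>(m := k)) \<in> ?C"
      by (rule image_eqI[of _ _ "(Suc m, \<beta>(m := k))"]) auto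
    ultimately show ?thesis
      by (intro bexI[of _ "?f (Suc m) (\<beta>(m := k))"] allI)
  qed
qed

section \<open>Jets of curves\<close>

text \<open>A curve is a map on the line and its derivative is the one in direction 1, which makes
  the results on \<open>gateaux_iter\<close> available for curves.\<close>

lemma iterated_deriv_eq_gateaux_iter:
  "(curve_deriv ^^ k) c = gateaux_iter k c (\<lambda>_. 1)"
proof (induction k)
  case (Suc k)
  have "gateaux b x 1 = curve_deriv b x" for b :: "real \<Rightarrow> 'a" and x
    by (simp add: gateaux_def curve_deriv_def)
  then show ?case by (intro ext) (simp add: Suc)
qed simp

lemma smooth_iterated_deriv:
  fixes c :: "real \<Rightarrow> 'a::locally_convex_space"
  shows "smooth c \<Longrightarrow> smooth ((curve_deriv ^^ k) c)"
  by (simp add: iterated_deriv_eq_gateaux_iter smooth_iter)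

lemma smooth_curve_deriv:
  fixes c :: "real \<Rightarrow> 'a::locally_convex_space"
  shows "smooth c \<Longrightarrow> smooth (curve_deriv c)"
  using smooth_iterated_deriv[of c 1] by simp

lemma smooth_has_curve_deriv:
  fixes c :: "real \<Rightarrow> 'a::locally_convex_space"
  assumes "smooth c"
  shows "has_curve_deriv c (curve_deriv c x) x"
  using C1_has_deriv[OF smooth_C1[OF assms], of 0 1 x]
    has_curve_deriv_imp_eq by fastforce

lemma smooth_has_iterated_deriv:
  fixes c :: "real \<Rightarrow> 'a::locally_convex_space"
  assumes "smooth c"
  shows "has_curve_deriv ((curve_deriv ^^ k) c) ((curve_deriv ^^ Suc k) c x) x"
  using smooth_has_curve_deriv[OF smooth_iterated_deriv[OF assms]] by simp

section \<open>Rules for iterated derivatives of curves\<close>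

lemma iterated_deriv_add:
  fixes c d :: "real \<Rightarrow> 'a::locally_convex_space"
  assumes "smooth c" "smooth d"
  shows "(curve_deriv ^^ k) (\<lambda>e. c e + d e) = (\<lambda>e. (curve_deriv ^^ k) c e + (curve_deriv ^^ k) d e)"
proof (induction k)
  case (Suc k)
  have "curve_deriv (\<lambda>e. (curve_deriv ^^ k) c e + (curve_deriv ^^ k) d e) x =
      (curve_deriv ^^ Suc k) c x + (curve_deriv ^^ Suc k) d x" for x
    by (intro has_curve_deriv_imp_eq has_curve_deriv_add smooth_has_iterated_deriv assms)
  then show ?case by (intro ext) (simp add: Suc)
qed simp

lemma iterated_deriv_scaleR:
  fixes c :: "real \<Rightarrow> 'a::locally_convex_space"
  assumes "smooth c"
  shows "(curve_deriv ^^ k) (\<lambda>e. a *\<^sub>R c e) = (\<lambda>e. a *\<^sub>R (curve_deriv ^^ k) c e)"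
proof (induction k)
  case (Suc k)
  have "curve_deriv (\<lambda>e. a *\<^sub>R (curve_deriv ^^ k) c e) x = a *\<^sub>R (curve_deriv ^^ Suc k) c x" for x
    by (intro has_curve_deriv_imp_eq has_curve_deriv_scale smooth_has_iterated_deriv assms)
  then show ?case by (intro ext) (simp add: Suc)
qed simp

lemma iterated_deriv_Pair:
  fixes c :: "real \<Rightarrow> 'a::locally_convex_space" and d :: "real \<Rightarrow> 'b::locally_convex_space"
  assumes "smooth c" "smooth d"
  shows "(curve_deriv ^^ k) (\<lambda>e. (c e, d e)) = (\<lambda>e. ((curve_deriv ^^ k) c e, (curve_deriv ^^ k) d e))"
proof (induction k)
  case (Suc k)
  have "curve_deriv (\<lambda>e. ((curve_deriv ^^ k) c e, (curve_deriv ^^ k) d e)) x =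
      ((curve_deriv ^^ Suc k) c x, (curve_deriv ^^ Suc k) d x)" for x
    by (intro has_curve_deriv_imp_eq has_curve_deriv_Pair smooth_has_iterated_deriv assms)
  then show ?case by (intro ext) (simp add: Suc)
qed simp

lemma iterated_deriv_const:
  fixes a :: "'a::locally_convex_space"
  shows "(curve_deriv ^^ k) (\<lambda>_. a) = (\<lambda>_. if k = 0 then a else 0)"
proof (induction k)
  case (Suc k)
  have "curve_deriv (\<lambda>_. b) x = 0" for b :: 'a and x
    by (intro has_curve_deriv_imp_eq has_curve_deriv_const)
  then show ?case by (intro ext) (simp add: Suc)
qed simp

lemma iterated_deriv_sum:
  fixes c :: "'i \<Rightarrow> real \<Rightarrow> 'a::locally_convex_space"
  assumes "\<And>i. i \<in> I \<Longrightarrow> smooth (c i)"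
  shows "(curve_deriv ^^ k) (\<lambda>e. \<Sum>i\<in>I. c i e) = (\<lambda>e. \<Sum>i\<in>I. (curve_deriv ^^ k) (c i) e)"
  using assms
proof (induction I rule: infinite_finite_induct)
  case (insert i I)
  then show ?case by (simp add: iterated_deriv_add smooth_sum)
qed (simp_all add: iterated_deriv_const)

section \<open>Smooth curves with equal Taylor coefficients at 0 up to a given order\<close>

definition jet_eq ::
    "nat \<Rightarrow> (real \<Rightarrow> 'a::locally_convex_space) \<Rightarrow> (real \<Rightarrow> 'a) \<Rightarrow> bool" where
  "jet_eq n c d \<longleftrightarrow> smooth c \<and> smooth d \<and> (\<forall>k\<le>n. (curve_deriv ^^ k) c 0 = (curve_deriv ^^ k) d 0)"

lemma jet_eq_refl: "smooth c \<Longrightarrow> jet_eq n c c"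
  by (simp add: jet_eq_def)

lemma jet_eq_mono: "jet_eq n c d \<Longrightarrow> k \<le> n \<Longrightarrow> jet_eq k c d"
  by (auto simp: jet_eq_def)

lemma jet_eq_curve_deriv:
  assumes "jet_eq (Suc n) c d"
  shows "jet_eq n (curve_deriv c) (curve_deriv d)"
proof -
  have "(curve_deriv ^^ k) (curve_deriv c) 0 = (curve_deriv ^^ k) (curve_deriv d) 0" if "k \<le> n" for k
    using assms that unfolding jet_eq_def
    by (metis Suc_le_mono comp_apply funpow_Suc_right)
  then show ?thesis
    using assms by (simp add: jet_eq_def smooth_curve_deriv)
qed

lemma jet_eq_Pair:
  assumes "jet_eq n c d" "jet_eq n c' d'"
  shows "jet_eq n (\<lambda>e. (c e, c' e)) (\<lambda>e. (d e, d' e))"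
  using assms by (simp add: jet_eq_def smooth_Pair iterated_deriv_Pair)

lemma curve_deriv_gateaux_iter:
  fixes F :: "'a::locally_convex_space \<Rightarrow> 'b::locally_convex_space"
  assumes F: "smooth F" and c: "smooth c" and g: "\<And>l. smooth (g l)"
  shows "curve_deriv (\<lambda>e. gateaux_iter m F (\<lambda>l. g l e) (c e)) =
    (\<lambda>e. gateaux_iter (Suc m) F (\<lambda>l. (g(m := curve_deriv c)) l e) (c e)
      + (\<Sum>p<m. gateaux_iter m F (\<lambda>l. (g(p := curve_deriv (g p))) l e) (c e)))"
proof
  fix x
  have eq: "(\<lambda>l. (g(p := b)) l x) = (\<lambda>l. g l x)(p := b x)" for p b
    by auto
  show "curve_deriv (\<lambda>e. gateaux_iter m F (\<lambda>l. g l e) (c e)) x =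
    gateaux_iter (Suc m) F (\<lambda>l. (g(m := curve_deriv c)) l x) (c x)
      + (\<Sum>p<m. gateaux_iter m F (\<lambda>l. (g(p := curve_deriv (g p))) l x) (c x))"
    unfolding eq
    by (intro has_curve_deriv_imp_eq has_curve_deriv_gateaux_iter F smooth_has_curve_deriv c g)
qed

text \<open>An induction on \<open>k\<close> in place of an explicit formula for higher derivatives
  of a composition. One derivative gives a sum of terms of the same shape, built from the old curves
  and their derivatives; equality up to order \<open>Suc k\<close> yields equality up to order
  \<open>k\<close> for both. The order \<open>m\<close> and all curves must therefore stay general
  in the induction.\<close>

lemma iterated_deriv_gateaux_iter_cong:
  fixes F :: "'a::locally_convex_space \<Rightarrow> 'b::locally_convex_space"
  assumes F: "smooth F" and c: "jet_eq k c d" and g: "\<And>l. jet_eq k (g l) (h l)"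
  shows "(curve_deriv ^^ k) (\<lambda>e. gateaux_iter m F (\<lambda>l. g l e) (c e)) 0 =
    (curve_deriv ^^ k) (\<lambda>e. gateaux_iter m F (\<lambda>l. h l e) (d e)) 0"
  using c g
proof (induction k arbitrary: m c d g h)
  case 0
  then show ?case by (simp add: jet_eq_def)
next
  case (Suc k)
  have smooth: "smooth c" "smooth d" "smooth (g l)" "smooth (h l)" for l
    using Suc.prems by (auto simp: jet_eq_def)
  have expand: "(curve_deriv ^^ Suc k) (\<lambda>e. gateaux_iter m F (\<lambda>l. g l e) (c e)) 0 =
      (curve_deriv ^^ k) (\<lambda>e. gateaux_iter (Suc m) F (\<lambda>l. (g(m := curve_deriv c)) l e) (c e)) 0
      + (\<Sum>p<m. (curve_deriv ^^ k) (\<lambda>e. gateaux_iter m F (\<lambda>l. (g(p := curve_deriv (g p))) l e) (c e)) 0)"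
    if c: "smooth c" and g: "\<And>l. smooth (g l)" for c g
  proof -
    have upd: "smooth ((g(p := b)) l)" if "smooth b" for p b l
      using g that by simp
    have "smooth (\<lambda>e. gateaux_iter (Suc m) F (\<lambda>l. (g(m := curve_deriv c)) l e) (c e))"
      by (intro smooth_gateaux_iter F c upd smooth_curve_deriv)
    moreover have *: "smooth (\<lambda>e. gateaux_iter m F (\<lambda>l. (g(p := curve_deriv (g p))) l e) (c e))" for p
      by (intro smooth_gateaux_iter F c g upd smooth_curve_deriv)
    ultimately show ?thesis
      unfolding funpow_Suc_right comp_apply curve_deriv_gateaux_iter[OF F c g]
      by (subst iterated_deriv_add) (intro smooth_sum | simp only: iterated_deriv_sum)+
  qed
  have c': "jet_eq k c d" "jet_eq k (curve_deriv c) (curve_deriv d)"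
    using Suc.prems(1) by (auto intro: jet_eq_mono jet_eq_curve_deriv)
  have g': "jet_eq k (g l) (h l)" "jet_eq k (curve_deriv (g l)) (curve_deriv (h l))" for l
    using Suc.prems(2)[of l] by (auto intro: jet_eq_mono jet_eq_curve_deriv)
  have upd: "jet_eq k ((g(p := a)) l) ((h(p := b)) l)" if "jet_eq k a b" for p a b l
    using that g' by simp
  show ?case
    unfolding expand[OF smooth(1,3)] expand[OF smooth(2,4)]
    by (intro arg_cong2[where f = "(+)"] sum.cong refl Suc.IH upd c' g')
qed

lemma jet_eq_gateaux_iter:
  fixes F :: "'a::locally_convex_space \<Rightarrow> 'b::locally_convex_space"
  assumes F: "smooth F" and c: "jet_eq n c d" and g: "\<And>l. jet_eq n (g l) (h l)"
  shows "jet_eq n (\<lambda>e. gateaux_iter m F (\<lambda>l. g l e) (c e)) (\<lambda>e. gateaux_iter m F (\<lambda>l. h l e) (d e))"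
proof -
  have "smooth c" "smooth d" "\<And>l. smooth (g l)" "\<And>l. smooth (h l)"
    using c g by (auto simp: jet_eq_def)
  moreover have "jet_eq k c d" "\<And>l. jet_eq k (g l) (h l)" if "k \<le> n" for k
    using c g that by (auto intro: jet_eq_mono)
  ultimately show ?thesis
    using F by (simp add: jet_eq_def[of n] smooth_gateaux_iter iterated_deriv_gateaux_iter_cong)
qed

lemma jet_eq_compose:
  fixes F :: "'a::locally_convex_space \<Rightarrow> 'b::locally_convex_space"
  assumes "smooth F" "jet_eq n c d"
  shows "jet_eq n (\<lambda>e. F (c e)) (\<lambda>e. F (d e))"
  using jet_eq_gateaux_iter[OF assms, of "\<lambda>_. c" "\<lambda>_. d" 0] assms by simp

lemma jet_eq_gateaux:
  fixes F :: "'a::locally_convex_space \<Rightarrow> 'b::locally_convex_space"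
  assumes "smooth F" "jet_eq n c d" "jet_eq n g h"
  shows "jet_eq n (\<lambda>e. gateaux F (c e) (g e)) (\<lambda>e. gateaux F (d e) (h e))"
  using jet_eq_gateaux_iter[OF assms(1,2), of "\<lambda>_. g" "\<lambda>_. h" 1] assms by simp

text \<open>The direction \<open>b\<close> is moved past the copies of \<open>a\<close> one at a
  time, each by symmetry of second derivatives.\<close>

lemma gateaux_gateaux_iter_commute:
  fixes H :: "'a::locally_convex_space \<Rightarrow> 'b::locally_convex_space"
  assumes H: "smooth H"
  shows "gateaux (gateaux_iter k H (\<lambda>_. a)) u b = gateaux_iter k (\<lambda>u. gateaux H u b) (\<lambda>_. a) u"
proof (induction k arbitrary: u)
  case (Suc k)
  let ?A = "gateaux_iter k H (\<lambda>_. a)"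
  have A: "smooth ?A" by (rule smooth_iter[OF H])
  have "gateaux (\<lambda>u. gateaux ?A u a) u b = gateaux (\<lambda>u. gateaux ?A u b) u a"
    by (intro gateaux_commute smooth_C1 A smooth_gateaux smooth_ident smooth_const)
  then show ?case by (simp add: Suc)
qed simp

text \<open>Derivatives in the curve parameter become derivatives on the product space along
  \<open>(1, 0)\<close>. A derivative in \<open>z\<close> is one along \<open>(0, w)\<close>, so
  exchanging the two is the commutation just proved.\<close>

lemma iterated_deriv_slice:
  fixes H :: "real \<times> 'a::locally_convex_space \<Rightarrow> 'b::locally_convex_space"
  shows "(curve_deriv ^^ k) (\<lambda>e. H (e, z)) x = gateaux_iter k H (\<lambda>_. (1, 0)) (x, z)"
proof (induction k arbitrary: x)
  case (Suc k)
  then have "(curve_deriv ^^ k) (\<lambda>e. H (e, z)) = (\<lambda>x. gateaux_iter k H (\<lambda>_. (1, 0)) (x, z))" by auto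
  moreover have "curve_deriv (\<lambda>x. A (x, z)) x = gateaux A (x, z) (1, 0)" for A :: "real \<times> 'a \<Rightarrow> 'b"
    by (simp add: gateaux_def curve_deriv_def)
  ultimately show ?case by simp
qed simp

lemma gateaux_slice: "gateaux (\<lambda>z. H (x, z)) z w = gateaux H (x, z) (0, w)"
  by (simp add: gateaux_def)

lemma smooth_iterated_deriv_slice:
  fixes H :: "real \<times> 'a::locally_convex_space \<Rightarrow> 'b::locally_convex_space"
  assumes H: "smooth H"
  shows "smooth (\<lambda>z. (curve_deriv ^^ k) (\<lambda>e. H (e, z)) x)"
  unfolding iterated_deriv_slice
  by (intro smooth_compose[OF smooth_iter[OF H]] smooth_Pair smooth_const smooth_ident)

lemma gateaux_iterated_deriv_slice:
  fixes H :: "real \<times> 'a::locally_convex_space \<Rightarrow> 'b::locally_convex_space"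
  assumes H: "smooth H"
  shows "gateaux (\<lambda>z. (curve_deriv ^^ k) (\<lambda>e. H (e, z)) x) z w =
    (curve_deriv ^^ k) (\<lambda>e. gateaux (\<lambda>z. H (e, z)) z w) x"
  unfolding iterated_deriv_slice gateaux_slice gateaux_slice[of "gateaux_iter k H (\<lambda>_. (1, 0))"]
    gateaux_gateaux_iter_commute[OF H]
  using iterated_deriv_slice[of k "\<lambda>u. gateaux H u (0, w)" z x] by simp

section \<open>The perturbation equation\<close>

text \<open>The Leibniz rule for the factor \<open>e\<close>, whose second derivative is 0. For
  \<open>k = 0\<close> the truncated \<open>k - 1\<close> is harmless because its coefficient
  vanishes.\<close>

lemma iterated_deriv_ident_scaleR:
  fixes f :: "real \<Rightarrow> 'a::locally_convex_space"
  assumes f: "smooth f"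
  shows "(curve_deriv ^^ k) (\<lambda>e. e *\<^sub>R f e) =
    (\<lambda>x. x *\<^sub>R (curve_deriv ^^ k) f x + real k *\<^sub>R (curve_deriv ^^ (k - 1)) f x)"
proof (induction k)
  case (Suc k)
  have "curve_deriv (\<lambda>x. x *\<^sub>R (curve_deriv ^^ k) f x + real k *\<^sub>R (curve_deriv ^^ (k - 1)) f x) x =
      (x *\<^sub>R (curve_deriv ^^ Suc k) f x + 1 *\<^sub>R (curve_deriv ^^ k) f x)
      + real k *\<^sub>R (curve_deriv ^^ Suc (k - 1)) f x" for x
    by (intro has_curve_deriv_imp_eq has_curve_deriv_add has_curve_deriv_scale
        has_curve_deriv_scaleR[OF has_curve_deriv_ident] smooth_has_iterated_deriv f)
  moreover have "real k *\<^sub>R (curve_deriv ^^ Suc (k - 1)) f x = real k *\<^sub>R (curve_deriv ^^ k) f x" for x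
    by (cases k) simp_all
  ultimately show ?case
    by (intro ext) (simp add: Suc algebra_simps)
qed simp

text \<open>Multiplication by \<open>e\<close> shifts the Taylor coefficients by one place, since
  \<open>k / fact k\<close> is \<open>1 / fact (k - 1)\<close> for positive \<open>k\<close>;
  iterate \<open>j\<close> times. This shift is what makes \<open>pert_block\<close> lower
  triangular.\<close>

lemma taylor_coeff_power_scaleR:
  fixes f :: "real \<Rightarrow> 'a::locally_convex_space"
  assumes f: "smooth f"
  shows "(1 / fact k) *\<^sub>R (curve_deriv ^^ k) (\<lambda>e. e ^ j *\<^sub>R f e) 0 =
    (if k < j then 0 else (1 / fact (k - j)) *\<^sub>R (curve_deriv ^^ (k - j)) f 0)"
proof (induction j arbitrary: k)
  case (Suc j)
  have "smooth (\<lambda>e. e ^ j *\<^sub>R f e)"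
    by (intro smooth_scaleR smooth_power smooth_ident f)
  then have eq: "(curve_deriv ^^ k) (\<lambda>e. e ^ Suc j *\<^sub>R f e) 0 =
      real k *\<^sub>R (curve_deriv ^^ (k - 1)) (\<lambda>e. e ^ j *\<^sub>R f e) 0"
    using iterated_deriv_ident_scaleR[of "\<lambda>e. e ^ j *\<^sub>R f e" k] by simp
  show ?case
  proof (cases k)
    case 0
    then show ?thesis by simp
  next
    case k: (Suc k')
    have "1 / fact k * real k = (1 / fact k' :: real)"
      unfolding k fact_Suc by (simp del: of_nat_Suc)
    then have "(1 / fact k) *\<^sub>R (curve_deriv ^^ k) (\<lambda>e. e ^ Suc j *\<^sub>R f e) 0 =
        (1 / fact k') *\<^sub>R (curve_deriv ^^ k') (\<lambda>e. e ^ j *\<^sub>R f e) 0"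
      unfolding eq scaleR_scaleR by (simp only: k diff_Suc_1)
    then show ?thesis
      unfolding Suc.IH by (simp add: k)
  qed
qed simp

text \<open>The Taylor expansion at 0, with its coefficients arranged by \<open>ix\<close>. Both
  \<open>pert_field\<close> and \<open>pert_op\<close> will be written in this form.\<close>

definition taylor_vec ::
    "('n::finite \<Rightarrow> nat) \<Rightarrow> (real \<Rightarrow> 'a::locally_convex_space) \<Rightarrow> 'a ^ 'n" where
  "taylor_vec ix c = (\<chi> i. (1 / fact (ix i)) *\<^sub>R (curve_deriv ^^ ix i) c 0)"

lemma taylor_vec_add:
  "smooth c \<Longrightarrow> smooth d \<Longrightarrow> taylor_vec ix (\<lambda>e. c e + d e) = taylor_vec ix c + taylor_vec ix d"
  by (simp add: taylor_vec_def vec_eq_iff iterated_deriv_add scaleR_add_right)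

lemma taylor_vec_scaleR:
  "smooth c \<Longrightarrow> taylor_vec ix (\<lambda>e. a *\<^sub>R c e) = a *\<^sub>R taylor_vec ix c"
  by (simp add: taylor_vec_def vec_eq_iff iterated_deriv_scaleR)

lemma taylor_vec_diff:
  assumes "smooth c" "smooth d"
  shows "taylor_vec ix (\<lambda>e. c e - d e) = taylor_vec ix c - taylor_vec ix d"
proof -
  have "smooth (\<lambda>e. - 1 *\<^sub>R d e)"
    by (intro smooth_scaleR smooth_const assms)
  from taylor_vec_add[OF assms(1) this, of ix] taylor_vec_scaleR[OF assms(2), of ix "- 1"] show ?thesis
    by simp
qed

lemma taylor_vec_zero: "taylor_vec ix (\<lambda>_. 0) = 0"
  by (simp add: taylor_vec_def vec_eq_iff iterated_deriv_const)

lemma taylor_vec_cong: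
  assumes "jet_eq n c d" "\<And>i. ix i \<le> n"
  shows "taylor_vec ix c = taylor_vec ix d"
  using assms by (simp add: taylor_vec_def vec_eq_iff jet_eq_def)

lemma smooth_taylor_vec:
  fixes H :: "real \<times> 'z::locally_convex_space \<Rightarrow> 'a::locally_convex_space"
  assumes "smooth H"
  shows "smooth (\<lambda>z. taylor_vec ix (\<lambda>e. H (e, z)))"
  unfolding taylor_vec_def
  by (intro smooth_vec smooth_scaleR smooth_const smooth_iterated_deriv_slice assms)

text \<open>In each component a derivative in the parameter \<open>z\<close> is exchanged with
  iterated derivatives of the curve.\<close>

lemma gateaux_taylor_vec:
  fixes H :: "real \<times> 'z::locally_convex_space \<Rightarrow> 'a::locally_convex_space"
  assumes H: "smooth H"
  shows "gateaux (\<lambda>z. taylor_vec ix (\<lambda>e. H (e, z))) z w = taylor_vec ix (\<lambda>e. gateaux (\<lambda>z. H (e, z)) z w)"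
proof (rule gateauxI, rule has_curve_deriv_vec)
  fix i
  have "has_curve_deriv (\<lambda>r. (1 / fact (ix i)) *\<^sub>R (curve_deriv ^^ ix i) (\<lambda>e. H (e, z + r *\<^sub>R w)) 0)
      ((1 / fact (ix i)) *\<^sub>R gateaux (\<lambda>z. (curve_deriv ^^ ix i) (\<lambda>e. H (e, z)) 0) z w) 0"
    by (intro has_curve_deriv_scale C1_has_deriv_0 smooth_C1 smooth_iterated_deriv_slice H)
  then show "has_curve_deriv (\<lambda>r. taylor_vec ix (\<lambda>e. H (e, z + r *\<^sub>R w)) $ i)
      (taylor_vec ix (\<lambda>e. gateaux (\<lambda>z. H (e, z)) z w) $ i) 0"
    by (simp add: taylor_vec_def gateaux_iterated_deriv_slice[OF H])
qed

section \<open>The perturbed vector field\<close>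

lemma pert_sum_add: "pert_sum ix e (\<eta> + \<sigma>) = pert_sum ix e \<eta> + pert_sum ix e \<sigma>"
  by (simp add: pert_sum_def scaleR_add_right sum.distrib)

lemma pert_sum_scaleR: "pert_sum ix e (a *\<^sub>R \<eta>) = a *\<^sub>R pert_sum ix e \<eta>"
  by (simp add: pert_sum_def scaleR_sum_right mult.commute)

lemma smooth_pert_sum:
  fixes f :: "'z::locally_convex_space \<Rightarrow> real" and G :: "'z \<Rightarrow> 'e::locally_convex_space ^ 'n::finite"
  assumes "smooth f" "smooth G"
  shows "smooth (\<lambda>z. pert_sum ix (f z) (G z))"
  unfolding pert_sum_def
  by (intro smooth_sum smooth_scaleR smooth_power assms(1) smooth_compose[OF smooth_vec_nth assms(2)])

text \<open>The left curve is the Taylor polynomial of \<open>c\<close> of degree \<open>N\<close>.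
  Surjectivity of \<open>ix\<close> provides a coordinate for every order up to \<open>N\<close>,
  and injectivity leaves exactly one summand of that order.\<close>

lemma jet_eq_pert_sum:
  fixes ix :: "'n::finite \<Rightarrow> nat"
  assumes ix: "bij_betw ix UNIV {0..N}" and c: "smooth c"
  shows "jet_eq N (\<lambda>e. pert_sum ix e (taylor_vec ix c)) c"
  unfolding jet_eq_def
proof (intro conjI allI impI)
  show "smooth (\<lambda>e. pert_sum ix e (taylor_vec ix c))"
    by (intro smooth_pert_sum smooth_ident smooth_const)
  fix k
  assume "k \<le> N"
  then obtain i where i: "ix i = k"
    using ix by (metis atLeastAtMost_iff bij_betw_iff_bijections le0)
  have inj: "ix j = k \<longleftrightarrow> j = i" for j
    using ix i by (auto simp: bij_betw_def inj_eq)
  let ?a = "taylor_vec ix c"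
  have "smooth (\<lambda>e. e ^ ix j *\<^sub>R ?a $ j)" for j
    by (intro smooth_scaleR smooth_power smooth_ident smooth_const)
  then have "(1 / fact k) *\<^sub>R (curve_deriv ^^ k) (\<lambda>e. pert_sum ix e ?a) 0 =
      (\<Sum>j\<in>UNIV. (1 / fact k) *\<^sub>R (curve_deriv ^^ k) (\<lambda>e. e ^ ix j *\<^sub>R ?a $ j) 0)"
    unfolding pert_sum_def
    by (simp add: iterated_deriv_sum scaleR_sum_right)
  \<comment> \<open>Each summand is a power of \<open>e\<close> times a constant: its coefficient of
    order \<open>k\<close> is 0 by the shift if \<open>ix j\<close> exceeds \<open>k\<close>, and a
    positive-order derivative of a constant if \<open>ix j\<close> is smaller.\<close>
  also have "\<dots> = (\<Sum>j\<in>UNIV. if ix j = k then ?a $ j else 0)"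
    by (intro sum.cong refl)
      (auto simp: taylor_coeff_power_scaleR smooth_const iterated_deriv_const)
  also have "\<dots> = (1 / fact k) *\<^sub>R (curve_deriv ^^ k) c 0"
    by (simp add: inj taylor_vec_def i)
  finally show "(curve_deriv ^^ k) (\<lambda>e. pert_sum ix e ?a) 0 = (curve_deriv ^^ k) c 0"
    by simp
qed (rule c)

lemma pert_field_eq: "pert_field ix K \<eta> = taylor_vec ix (\<lambda>e. K (pert_sum ix e \<eta>))"
  by (simp add: pert_field_def taylor_vec_def)

lemma smooth_pert_field_family:
  fixes K :: "'e::locally_convex_space \<Rightarrow> 'e"
  assumes "smooth K"
  shows "smooth (\<lambda>p::real \<times> ('e ^ 'n::finite). K (pert_sum ix (fst p) (snd p)))"
  by (intro smooth_compose[OF assms] smooth_pert_sum smooth_fst smooth_snd)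

lemma smooth_pert_field:
  assumes "smooth K"
  shows "smooth (pert_field ix K)"
  using smooth_taylor_vec[OF smooth_pert_field_family[OF assms], of ix ix]
  by (simp add: pert_field_eq[abs_def])

text \<open>For fixed \<open>e\<close> the map \<open>pert_sum ix e\<close> is linear, so it carries
  the direction \<open>v\<close> to the direction \<open>pert_sum ix e v\<close> for
  \<open>K\<close>; then the derivative is taken inside the Taylor coefficients.\<close>

lemma gateaux_pert_field:
  assumes "smooth K"
  shows "gateaux (pert_field ix K) \<eta> v =
    taylor_vec ix (\<lambda>e. gateaux K (pert_sum ix e \<eta>) (pert_sum ix e v))"
proof -
  have "gateaux (\<lambda>\<eta>. K (pert_sum ix e \<eta>)) \<eta> v = gateaux K (pert_sum ix e \<eta>) (pert_sum ix e v)" for e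
    by (simp add: gateaux_def pert_sum_add pert_sum_scaleR)
  then show ?thesis
    using gateaux_taylor_vec[OF smooth_pert_field_family[OF assms], of ix ix]
    by (simp add: pert_field_eq[abs_def])
qed

section \<open>The perturbed operator\<close>

context
  fixes \<Phi> :: "real \<Rightarrow> 'e::locally_convex_space \<Rightarrow> 'e \<Rightarrow> 'e"
  assumes \<Phi>: "linear_operator \<Phi>"
begin

lemma smooth_op:
  fixes f :: "'z::locally_convex_space \<Rightarrow> real"
  assumes "smooth f" "smooth g" "smooth h"
  shows "smooth (\<lambda>z. \<Phi> (f z) (g z) (h z))"
proof -
  have "smooth (\<lambda>(t, u, w). \<Phi> t u w)"
    using \<Phi> by (simp add: linear_operator_def)
  from smooth_compose[OF this smooth_Pair[OF assms(1) smooth_Pair[OF assms(2,3)]]]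
  show ?thesis by simp
qed

lemma linear_op: "linear (\<Phi> t u)"
  using \<Phi> by (simp add: linear_operator_def)

text \<open>Linearity of \<Phi> in its last argument pulls the powers of \<open>e\<close> out of the
  sum, and each power shifts the Taylor coefficients, which reproduces the blocks.\<close>

lemma pert_op_eq:
  fixes ix :: "'n::finite \<Rightarrow> nat"
  shows "pert_op ix \<Phi> t \<eta> \<sigma> = taylor_vec ix (\<lambda>e. \<Phi> t (pert_sum ix e \<eta>) (pert_sum ix e \<sigma>))"
proof (subst vec_eq_iff, intro allI)
  fix i
  have u: "smooth (\<lambda>e. pert_sum ix e \<eta>)"
    by (intro smooth_pert_sum smooth_ident smooth_const)
  have s: "smooth (\<lambda>e. \<Phi> t (pert_sum ix e \<eta>) w)" for w
    by (intro smooth_op u smooth_const)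
  have "\<Phi> t (pert_sum ix e \<eta>) (pert_sum ix e \<sigma>) = (\<Sum>j\<in>UNIV. e ^ ix j *\<^sub>R \<Phi> t (pert_sum ix e \<eta>) (\<sigma> $ j))" for e
    unfolding pert_sum_def[of ix e \<sigma>] by (simp add: linear_sum[OF linear_op] linear_scale[OF linear_op])
  then have "taylor_vec ix (\<lambda>e. \<Phi> t (pert_sum ix e \<eta>) (pert_sum ix e \<sigma>)) $ i =
      (\<Sum>j\<in>UNIV. (1 / fact (ix i)) *\<^sub>R (curve_deriv ^^ ix i) (\<lambda>e. e ^ ix j *\<^sub>R \<Phi> t (pert_sum ix e \<eta>) (\<sigma> $ j)) 0)"
    by (simp add: taylor_vec_def iterated_deriv_sum smooth_scaleR smooth_power smooth_ident s scaleR_sum_right)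
  then show "pert_op ix \<Phi> t \<eta> \<sigma> $ i = taylor_vec ix (\<lambda>e. \<Phi> t (pert_sum ix e \<eta>) (pert_sum ix e \<sigma>)) $ i"
    by (simp add: pert_op_def pert_block_def taylor_coeff_power_scaleR s)
qed

lemma smooth_pert_op_family:
  "smooth (\<lambda>p::real \<times> real \<times> ('e ^ 'n::finite) \<times> ('e ^ 'n).
    \<Phi> (fst (snd p)) (pert_sum ix (fst p) (fst (snd (snd p)))) (pert_sum ix (fst p) (snd (snd (snd p)))))"
  by (intro smooth_op smooth_pert_sum smooth_fst smooth_compose[OF smooth_fst] smooth_compose[OF smooth_snd]
      smooth_snd)

lemma linear_operator_pert_op:
  fixes ix :: "'n::finite \<Rightarrow> nat"
  shows "linear_operator (pert_op ix \<Phi>)"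
  unfolding linear_operator_def
proof (intro conjI allI)
  fix t \<eta>
  have s: "smooth (\<lambda>e. \<Phi> t (pert_sum ix e \<eta>) (pert_sum ix e \<sigma>))" for \<sigma> :: "'e ^ 'n"
    by (intro smooth_op smooth_pert_sum smooth_ident smooth_const)
  show "linear (pert_op ix \<Phi> t \<eta>)"
    by (intro linearI)
      (simp_all add: pert_op_eq pert_sum_add pert_sum_scaleR linear_add[OF linear_op]
        linear_scale[OF linear_op] taylor_vec_add taylor_vec_scaleR s)
next
  show "smooth (\<lambda>(t, \<eta>, \<sigma>). pert_op ix \<Phi> t \<eta> \<sigma>)"
    using smooth_taylor_vec[OF smooth_pert_op_family, of ix ix]
    by (simp add: pert_op_eq case_prod_unfold)
qed

lemma jet_eq_op:
  assumes "jet_eq n u u'" "jet_eq n w w'"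
  shows "jet_eq n (\<lambda>e. \<Phi> t (u e) (w e)) (\<lambda>e. \<Phi> t (u' e) (w' e))"
proof -
  have "smooth (\<lambda>p. \<Phi> t (fst p) (snd p))"
    by (intro smooth_op smooth_const smooth_fst smooth_snd)
  from jet_eq_compose[OF this jet_eq_Pair[OF assms]] show ?thesis by simp
qed

text \<open>Keeping \<open>w\<close> fixed amounts to direction \<open>(v, 0)\<close> for the joint
  map on pairs, to which the results on smooth maps and jets apply.\<close>

lemma op_gateaux_eq:
  "op_gateaux \<Phi> t u v w = gateaux (\<lambda>p. \<Phi> t (fst p) (snd p)) (u, w) (v, 0)"
  by (simp add: op_gateaux_def gateaux_def)

lemma jet_eq_op_gateaux:
  assumes "jet_eq n u u'" "jet_eq n v v'" "jet_eq n w w'"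
  shows "jet_eq n (\<lambda>e. op_gateaux \<Phi> t (u e) (v e) (w e)) (\<lambda>e. op_gateaux \<Phi> t (u' e) (v' e) (w' e))"
  unfolding op_gateaux_eq
  by (intro jet_eq_gateaux jet_eq_Pair assms jet_eq_refl smooth_const smooth_op smooth_fst smooth_snd)

lemma smooth_op_time_deriv:
  fixes u w :: "real \<Rightarrow> 'e"
  assumes "smooth u" "smooth w"
  shows "smooth (\<lambda>e. op_time_deriv \<Phi> t (u e) (w e))"
proof -
  have "op_time_deriv \<Phi> t x y = gateaux (\<lambda>p. \<Phi> (fst p) (fst (snd p)) (snd (snd p))) (t, x, y) (1, 0, 0)" for x y
    by (simp add: op_time_deriv_def gateaux_def curve_deriv_def)
  moreover have "smooth (\<lambda>p. \<Phi> (fst p) (fst (snd p)) (snd (snd p)))"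
    by (intro smooth_op smooth_fst smooth_compose[OF smooth_fst] smooth_compose[OF smooth_snd] smooth_snd)
  ultimately show ?thesis
    by (simp add: smooth_gateaux smooth_Pair smooth_const assms)
qed

text \<open>Explicit time is treated as the parameter: the time derivative is the Gateaux derivative
  in direction 1 and passes inside the Taylor coefficients.\<close>

lemma op_time_deriv_pert_op:
  fixes ix :: "'n::finite \<Rightarrow> nat"
  shows "op_time_deriv (pert_op ix \<Phi>) t \<eta> \<sigma> =
    taylor_vec ix (\<lambda>e. op_time_deriv \<Phi> t (pert_sum ix e \<eta>) (pert_sum ix e \<sigma>))"
proof -
  have time: "curve_deriv c t = gateaux c t 1" for c :: "real \<Rightarrow> 'b::locally_convex_space"
    by (simp add: gateaux_def curve_deriv_def)
  have "smooth (\<lambda>p::real \<times> real. \<Phi> (snd p) (pert_sum ix (fst p) \<eta>) (pert_sum ix (fst p) \<sigma>))"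
    by (intro smooth_op smooth_pert_sum smooth_fst smooth_snd smooth_const)
  from gateaux_taylor_vec[OF this, of ix t 1] show ?thesis
    by (simp add: op_time_deriv_def pert_op_eq time)
qed

lemma op_gateaux_pert_op:
  fixes ix :: "'n::finite \<Rightarrow> nat"
  shows "op_gateaux (pert_op ix \<Phi>) t \<eta> v \<sigma> =
    taylor_vec ix (\<lambda>e. op_gateaux \<Phi> t (pert_sum ix e \<eta>) (pert_sum ix e v) (pert_sum ix e \<sigma>))"
proof -
  have "smooth (\<lambda>p::real \<times> ('e ^ 'n). \<Phi> t (pert_sum ix (fst p) (snd p)) (pert_sum ix (fst p) \<sigma>))"
    by (intro smooth_op smooth_pert_sum smooth_fst smooth_snd smooth_const)
  from gateaux_taylor_vec[OF this, of ix \<eta> v] show ?thesis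
    by (simp add: op_gateaux_def pert_op_eq gateaux_def[of "\<lambda>z. \<Phi> t (pert_sum ix _ z) _"]
        gateaux_def[of "\<lambda>x. \<Phi> t x _"] pert_sum_add pert_sum_scaleR)
qed

end

section \<open>Transfer of the recursion and hereditary identities\<close>

context
  fixes ix :: "'n::finite \<Rightarrow> nat" and N :: nat and K :: "'e::locally_convex_space \<Rightarrow> 'e"
    and \<Phi> :: "real \<Rightarrow> 'e \<Rightarrow> 'e \<Rightarrow> 'e"
  assumes ix: "bij_betw ix UNIV {0..N}" and K: "smooth K" and \<Phi>: "linear_operator \<Phi>"
begin

lemma smooth_pert_sum_curve: "smooth (\<lambda>e. pert_sum ix e (\<eta> :: 'e ^ 'n))"
  by (intro smooth_pert_sum smooth_ident smooth_const)

lemma ix_le: "ix i \<le> N"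
  using bij_betw_apply[OF ix, of i] by simp

text \<open>Needed for nested expressions, where the argument is itself a Taylor vector. Summing it
  up returns only the Taylor polynomial of \<open>w\<close>, but this has the same coefficients as
  \<open>w\<close> up to order \<open>N\<close>, and the outer Taylor vector sees no more.\<close>

lemma pert_op_taylor_vec:
  assumes "smooth w"
  shows "pert_op ix \<Phi> t \<eta> (taylor_vec ix w) = taylor_vec ix (\<lambda>e. \<Phi> t (pert_sum ix e \<eta>) (w e))"
  unfolding pert_op_eq[OF \<Phi>]
  by (rule taylor_vec_cong[OF _ ix_le])
    (intro jet_eq_op[OF \<Phi>] jet_eq_refl smooth_pert_sum_curve jet_eq_pert_sum ix assms)

lemma op_gateaux_pert_op_taylor_vec:
  assumes "smooth v"
  shows "op_gateaux (pert_op ix \<Phi>) t \<eta> (taylor_vec ix v) \<sigma> =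
    taylor_vec ix (\<lambda>e. op_gateaux \<Phi> t (pert_sum ix e \<eta>) (v e) (pert_sum ix e \<sigma>))"
  unfolding op_gateaux_pert_op[OF \<Phi>]
  by (rule taylor_vec_cong[OF _ ix_le])
    (intro jet_eq_op_gateaux[OF \<Phi>] jet_eq_refl smooth_pert_sum_curve jet_eq_pert_sum ix assms)

lemma gateaux_pert_field_taylor_vec:
  assumes "smooth v"
  shows "gateaux (pert_field ix K) \<eta> (taylor_vec ix v) =
    taylor_vec ix (\<lambda>e. gateaux K (pert_sum ix e \<eta>) (v e))"
  unfolding gateaux_pert_field[OF K]
  by (rule taylor_vec_cong[OF _ ix_le])
    (intro jet_eq_gateaux K jet_eq_refl smooth_pert_sum_curve jet_eq_pert_sum ix assms)

lemma smooth_op_gateaux: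
  fixes u v w :: "real \<Rightarrow> 'e"
  assumes "smooth u" "smooth v" "smooth w"
  shows "smooth (\<lambda>e. op_gateaux \<Phi> t (u e) (v e) (w e))"
  unfolding op_gateaux_eq[OF \<Phi>]
  by (intro smooth_gateaux smooth_op[OF \<Phi>] smooth_Pair smooth_fst smooth_snd smooth_const assms)

lemma recursion_operator_pert:
  assumes rec: "recursion_operator K \<Phi>"
  shows "recursion_operator (pert_field ix K) (pert_op ix \<Phi>)"
proof -
  \<comment> \<open>Constant vector fields turn the identity for vector fields into one for
    arbitrary tangent vectors, which is needed because \<open>w\<close> will run along a
    curve.\<close>
  have id: "op_time_deriv \<Phi> t u w + op_gateaux \<Phi> t u (K u) w - gateaux K u (\<Phi> t u w)
      + \<Phi> t u (gateaux K u w) = 0" for t u w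
  proof -
    have "vector_field (\<lambda>_::'e. w)"
      by (simp add: vector_field_def smooth_const)
    with rec show ?thesis unfolding recursion_operator_def by blast
  qed
  have "op_time_deriv (pert_op ix \<Phi>) t \<eta> \<sigma> + op_gateaux (pert_op ix \<Phi>) t \<eta> (pert_field ix K \<eta>) \<sigma>
      - gateaux (pert_field ix K) \<eta> (pert_op ix \<Phi> t \<eta> \<sigma>)
      + pert_op ix \<Phi> t \<eta> (gateaux (pert_field ix K) \<eta> \<sigma>) = 0" for t \<eta> \<sigma>
  proof -
    let ?u = "\<lambda>e. pert_sum ix e \<eta>" and ?w = "\<lambda>e. pert_sum ix e \<sigma>"
    note u = smooth_pert_sum_curve[of \<eta>] and w = smooth_pert_sum_curve[of \<sigma>]
    have Ku: "smooth (\<lambda>e. K (?u e))" by (rule smooth_compose[OF K u])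
    have Pw: "smooth (\<lambda>e. \<Phi> t (?u e) (?w e))" by (intro smooth_op[OF \<Phi>] smooth_const u w)
    have Kw: "smooth (\<lambda>e. gateaux K (?u e) (?w e))" by (intro smooth_gateaux K u w)
    have s: "smooth (\<lambda>e. op_time_deriv \<Phi> t (?u e) (?w e))"
      "smooth (\<lambda>e. op_gateaux \<Phi> t (?u e) (K (?u e)) (?w e))"
      "smooth (\<lambda>e. gateaux K (?u e) (\<Phi> t (?u e) (?w e)))"
      "smooth (\<lambda>e. \<Phi> t (?u e) (gateaux K (?u e) (?w e)))"
      by (intro smooth_op_time_deriv[OF \<Phi>] smooth_op_gateaux smooth_gateaux smooth_op[OF \<Phi>] K u w Ku Pw Kw smooth_const)+
    \<comment> \<open>The inner perturbed values are rewritten as Taylor vectors by instantiated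
      equations; the outer operators then act on Taylor vectors of smooth curves.\<close>
    have "?thesis \<longleftrightarrow>
        taylor_vec ix (\<lambda>e. op_time_deriv \<Phi> t (?u e) (?w e))
        + taylor_vec ix (\<lambda>e. op_gateaux \<Phi> t (?u e) (K (?u e)) (?w e))
        - taylor_vec ix (\<lambda>e. gateaux K (?u e) (\<Phi> t (?u e) (?w e)))
        + taylor_vec ix (\<lambda>e. \<Phi> t (?u e) (gateaux K (?u e) (?w e))) = 0"
      unfolding pert_field_eq[of ix K \<eta>] pert_op_eq[OF \<Phi>, of ix t \<eta> \<sigma>] gateaux_pert_field[OF K, of ix \<eta> \<sigma>]
        op_time_deriv_pert_op[OF \<Phi>] op_gateaux_pert_op_taylor_vec[OF Ku]
        gateaux_pert_field_taylor_vec[OF Pw] pert_op_taylor_vec[OF Kw] ..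
    also have "\<dots> \<longleftrightarrow> taylor_vec ix (\<lambda>e. op_time_deriv \<Phi> t (?u e) (?w e)
        + op_gateaux \<Phi> t (?u e) (K (?u e)) (?w e) - gateaux K (?u e) (\<Phi> t (?u e) (?w e))
        + \<Phi> t (?u e) (gateaux K (?u e) (?w e))) = 0"
      by (simp add: taylor_vec_add taylor_vec_diff smooth_add smooth_diff s)
    \<comment> \<open>All terms are now under one Taylor vector, whose curve is identically 0 by the
      original identity.\<close>
    finally show ?thesis by (simp add: id taylor_vec_zero)
  qed
  then show ?thesis
    by (simp add: recursion_operator_def vector_field_def smooth_pert_field K linear_operator_pert_op \<Phi>)
qed

lemma hereditary_pert_op:
  assumes her: "hereditary \<Phi>"
  shows "hereditary (pert_op ix \<Phi>)"
proof -
  \<comment> \<open>Again constant fields, here two of them, give the identity for arbitrary pairs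
    of tangent vectors.\<close>
  have id: "op_gateaux \<Phi> t u (\<Phi> t u k) w - \<Phi> t u (op_gateaux \<Phi> t u k w)
      - op_gateaux \<Phi> t u (\<Phi> t u w) k + \<Phi> t u (op_gateaux \<Phi> t u w k) = 0" for t u k w
  proof -
    have "vector_field (\<lambda>_::'e. k)" "vector_field (\<lambda>_::'e. w)"
      by (simp_all add: vector_field_def smooth_const)
    with her show ?thesis unfolding hereditary_def by blast
  qed
  have "op_gateaux (pert_op ix \<Phi>) t \<eta> (pert_op ix \<Phi> t \<eta> \<kappa>) \<sigma>
      - pert_op ix \<Phi> t \<eta> (op_gateaux (pert_op ix \<Phi>) t \<eta> \<kappa> \<sigma>)
      - op_gateaux (pert_op ix \<Phi>) t \<eta> (pert_op ix \<Phi> t \<eta> \<sigma>) \<kappa>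
      + pert_op ix \<Phi> t \<eta> (op_gateaux (pert_op ix \<Phi>) t \<eta> \<sigma> \<kappa>) = 0" for t \<eta> \<kappa> \<sigma>
  proof -
    let ?u = "\<lambda>e. pert_sum ix e \<eta>" and ?k = "\<lambda>e. pert_sum ix e \<kappa>" and ?w = "\<lambda>e. pert_sum ix e \<sigma>"
    note u = smooth_pert_sum_curve[of \<eta>] and w = smooth_pert_sum_curve
    have P: "smooth (\<lambda>e. \<Phi> t (?u e) (pert_sum ix e \<rho>))" for \<rho>
      by (intro smooth_op[OF \<Phi>] smooth_const u w)
    have D: "smooth (\<lambda>e. op_gateaux \<Phi> t (?u e) (pert_sum ix e \<rho>) (pert_sum ix e \<tau>))" for \<rho> \<tau>
      by (intro smooth_op_gateaux u w)
    \<comment> \<open>Stated for arbitrary directions because the hereditary identity contains each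
      kind of term twice, with \<kappa> and \<sigma> interchanged.\<close>
    have 1: "op_gateaux (pert_op ix \<Phi>) t \<eta> (pert_op ix \<Phi> t \<eta> \<rho>) \<tau> =
        taylor_vec ix (\<lambda>e. op_gateaux \<Phi> t (?u e) (\<Phi> t (?u e) (pert_sum ix e \<rho>)) (pert_sum ix e \<tau>))" for \<rho> \<tau>
      unfolding pert_op_eq[OF \<Phi>, of ix t \<eta> \<rho>] by (rule op_gateaux_pert_op_taylor_vec[OF P])
    have 2: "pert_op ix \<Phi> t \<eta> (op_gateaux (pert_op ix \<Phi>) t \<eta> \<rho> \<tau>) =
        taylor_vec ix (\<lambda>e. \<Phi> t (?u e) (op_gateaux \<Phi> t (?u e) (pert_sum ix e \<rho>) (pert_sum ix e \<tau>)))" for \<rho> \<tau>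
      unfolding op_gateaux_pert_op[OF \<Phi>] by (rule pert_op_taylor_vec[OF D])
    have s: "smooth (\<lambda>e. op_gateaux \<Phi> t (?u e) (\<Phi> t (?u e) (pert_sum ix e \<rho>)) (pert_sum ix e \<tau>))"
      "smooth (\<lambda>e. \<Phi> t (?u e) (op_gateaux \<Phi> t (?u e) (pert_sum ix e \<rho>) (pert_sum ix e \<tau>)))" for \<rho> \<tau>
      by (intro smooth_op_gateaux smooth_op[OF \<Phi>] smooth_const u w P D)+
    have "?thesis \<longleftrightarrow> taylor_vec ix (\<lambda>e. op_gateaux \<Phi> t (?u e) (\<Phi> t (?u e) (?k e)) (?w e)
        - \<Phi> t (?u e) (op_gateaux \<Phi> t (?u e) (?k e) (?w e))
        - op_gateaux \<Phi> t (?u e) (\<Phi> t (?u e) (?w e)) (?k e)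
        + \<Phi> t (?u e) (op_gateaux \<Phi> t (?u e) (?w e) (?k e))) = 0"
      unfolding 1 2 by (simp add: taylor_vec_add taylor_vec_diff smooth_add smooth_diff s)
    then show ?thesis by (simp add: id taylor_vec_zero)
  qed
  then show ?thesis
    by (simp add: hereditary_def linear_operator_pert_op \<Phi>)
qed

end

theorem theorem3p1:
  fixes K :: "'e::locally_convex_space \<Rightarrow> 'e"
    and \<Phi> :: "real \<Rightarrow> 'e \<Rightarrow> 'e \<Rightarrow> 'e"
    and N :: nat
    and ix :: "'n::finite \<Rightarrow> nat"
  assumes "N \<ge> 1"
    and "bij_betw ix UNIV {0..N}"
    and "vector_field K"
    and "linear_operator \<Phi>"
  shows "(recursion_operator K \<Phi> \<longrightarrow>
            recursion_operator (pert_field ix K) (pert_op ix \<Phi>)) \<and>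
         (recursion_operator K \<Phi> \<and> hereditary \<Phi> \<longrightarrow>
            recursion_operator (pert_field ix K) (pert_op ix \<Phi>) \<and> hereditary (pert_op ix \<Phi>))"
  using assms recursion_operator_pert hereditary_pert_op
  unfolding vector_field_def by blast

end
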